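(* Let $\delta>0$ be real with $\delta\neq1$, and fix a choice of sign $\pm$. Then the linear categories of partitions $$\langle\mathcal{V}_{(\delta,\pm)}\mathsf{aaa}\rangle_{\delta-1}\qquad\text{and}\qquad\langle\mathcal{V}_{(\delta,\pm)}\mathsf{aaaa}\rangle_{\delta-1}$$ (with loop parameter $\delta-1$) are both non-easy.
   Context: For $k,l\in\mathbb{N}_0$ let $\mathscr{P}(k,l)$ be the set of set partitions of $k$ upper points $1,\dots,k$ and $l$ lower points $1',\dots,l'$ (both ordered left to right). For $\delta\in\mathbb{C}$ let $\mathbf{Part}_\delta(k,l)$ be the complex vector space with basis $\mathscr{P}(k,l)$. Category operations: (i) tensor product $p\otimes q$: place $p$ and $q$ side by side ($p$ on the left), extended bilinearly; (ii) composition (depending on the loop parameter $\delta$): for $p\in\mathscr{P}(k,l)$, $q\in\mathscr{P}(l,m)$, identify the lower points of $p$ with the upper points of $q$, let $r\in\mathscr{P}(k,m)$ be the induced partition on the upper points of $p$ and lower points of $q$, and put $qp=\delta^{c}r$, where $c$ is the number of connected components consisting only of middle points; extended bilinearly; (iii) involution $p\mapsto p^*$: interchange the upper and lower rows, extended antilinearly. A linear category of partitions (with loop parameter $\delta$) is a collection of subspaces $\mathscr{K}(k,l)\subseteq\mathbf{Part}_\delta(k,l)$ containing the identity partition $\{1,1'\}\in\mathscr{P}(1,1)$ and the pair partition $\{1',2'\}\in\mathscr{P}(0,2)$ and closed under the category operations. $\langle p_1,\dots,p_n\rangle_\delta$ is the smallest linear category of partitions containing $p_1,\dots,p_n\in\mathbf{Part}_\delta$.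 $\mathscr{K}$ is easy if for all $k,l$ there is a set $\mathscr{C}(k,l)\subseteq\mathscr{P}(k,l)$ with $\mathscr{K}(k,l)=\operatorname{span}\mathscr{C}(k,l)$; otherwise non-easy. $\mathsf{aaa}\in\mathscr{P}(0,3)$ and $\mathsf{aaaa}\in\mathscr{P}(0,4)$ are the partitions of 3, resp. 4, lower points into a single block. For $\delta>0$, $\delta\ne1$, put $$\upsilon_{(\delta-1,\pm)}:=\mathrm{id}-\frac{1}{\delta-1}\Big(1\pm\frac{1}{\sqrt{\delta}}\Big)d\ \in\mathbf{Part}_{\delta-1}(1,1),$$ where $\mathrm{id}$ has the single block $\{1,1'\}$ and $d$ has blocks $\{1\},\{1'\}$. The linear map $\mathcal{B}_{(\delta)}:\mathbf{Part}_\delta(k,l)\to\mathbf{Part}_{\delta-1}(k,l)$ is defined on a partition $p$ by replacing (multilinearly) every block of $m$ points by (that block) $+(-1)^m$ (those $m$ points as singletons). Finally $\mathcal{V}_{(\delta,\pm)}p:=\upsilon_{(\delta-1,\pm)}^{\otimes l}\,(\mathcal{B}_{(\delta)}p)\,\upsilon_{(\delta-1,\pm)}^{\otimes k}$ for $p\in\mathbf{Part}_\delta(k,l)$, the compositions being taken with loop parameter $\delta-1$. *)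

theory Defs
  imports Complex_Main "HOL-Library.Poly_Mapping" "HOL-Library.Disjoint_Sets"
begin

section \<open>Set partitions of two rows of points\<close>

datatype point = Upper nat | Lower nat

type_synonym partition = "point set set"

definition points :: "nat \<Rightarrow> nat \<Rightarrow> point set" where
  "points k l = Upper ` {1..k} \<union> Lower ` {1..l}"

definition Partitions :: "nat \<Rightarrow> nat \<Rightarrow> partition set" where
  "Partitions k l = {p. partition_on (points k l) p}"

fun shift_point :: "nat \<Rightarrow> nat \<Rightarrow> point \<Rightarrow> point" where
  "shift_point k l (Upper i) = Upper (k + i)"
| "shift_point k l (Lower j) = Lower (l + j)"

text \<open>The numbers \<open>k\<close>, \<open>l\<close> of upper and lower points of the left factor \<open>p\<close> are passed explicitly.\<close>

definition tensor_partition :: "nat \<Rightarrow> nat \<Rightarrow> partition \<Rightarrow> partition \<Rightarrow> partition" where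
  "tensor_partition k l p q = p \<union> (`) (shift_point k l) ` q"

fun flip_point :: "point \<Rightarrow> point" where
  "flip_point (Upper i) = Lower i"
| "flip_point (Lower j) = Upper j"

definition flip_partition :: "partition \<Rightarrow> partition" where
  "flip_partition p = (`) flip_point ` p"

text \<open>
  For the composition \<open>q p\<close>, draw \<open>p\<close> above \<open>q\<close> on three rows of vertices, the lower points of \<open>p\<close>
  and the upper points of \<open>q\<close> both becoming the middle row.
\<close>

datatype vertex = Top nat | Mid nat | Bot nat

fun upper_half :: "point \<Rightarrow> vertex" where
  "upper_half (Upper i) = Top i"
| "upper_half (Lower j) = Mid j"

fun lower_half :: "point \<Rightarrow> vertex" where
  "lower_half (Upper i) = Mid i"
| "lower_half (Lower j) = Bot j"

fun outer :: "point \<Rightarrow> vertex" where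
  "outer (Upper i) = Top i"
| "outer (Lower j) = Bot j"

definition stack :: "partition \<Rightarrow> partition \<Rightarrow> vertex set set" where
  "stack p q = (`) upper_half ` p \<union> (`) lower_half ` q"

definition linked :: "partition \<Rightarrow> partition \<Rightarrow> (vertex \<times> vertex) set" where
  "linked p q = {(x, y). \<exists>B\<in>stack p q. x \<in> B \<and> y \<in> B}"

definition components :: "partition \<Rightarrow> partition \<Rightarrow> vertex set set" where
  "components p q = \<Union>(stack p q) // (linked p q)\<^sup>+"

definition loops :: "partition \<Rightarrow> partition \<Rightarrow> nat" where
  "loops p q = card {C \<in> components p q. C \<subseteq> range Mid}"

definition comp_partition :: "partition \<Rightarrow> partition \<Rightarrow> partition" where
  "comp_partition q p = (-`) outer ` components p q - {{}}"


section \<open>The spaces of linear combinations of partitions\<close>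

type_synonym lin_partition = "partition \<Rightarrow>\<^sub>0 complex"

definition scale :: "complex \<Rightarrow> lin_partition \<Rightarrow> lin_partition" where
  "scale c x = Poly_Mapping.map ((*) c) x"

lemma lookup_scale [simp]: "Poly_Mapping.lookup (scale c x) p = c * Poly_Mapping.lookup x p"
  by (simp add: scale_def Poly_Mapping.map.rep_eq when_def)

global_interpretation part: vector_space scale
  by unfold_locales (auto intro!: poly_mapping_eqI simp: lookup_add algebra_simps)

definition basis :: "partition \<Rightarrow> lin_partition" where
  "basis p = Poly_Mapping.single p 1"

definition Part :: "nat \<Rightarrow> nat \<Rightarrow> lin_partition set" where
  "Part k l = {x. Poly_Mapping.keys x \<subseteq> Partitions k l}"

definition tensor :: "nat \<Rightarrow> nat \<Rightarrow> lin_partition \<Rightarrow> lin_partition \<Rightarrow> lin_partition" where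
  "tensor k l x y = (\<Sum>p\<in>Poly_Mapping.keys x. \<Sum>q\<in>Poly_Mapping.keys y.
     scale (Poly_Mapping.lookup x p * Poly_Mapping.lookup y q) (basis (tensor_partition k l p q)))"

text \<open>\<open>composite \<delta> y x\<close> is the composite \<open>y x\<close>, with \<open>x\<close> on top.\<close>

definition composite :: "complex \<Rightarrow> lin_partition \<Rightarrow> lin_partition \<Rightarrow> lin_partition" where
  "composite \<delta> y x = (\<Sum>p\<in>Poly_Mapping.keys x. \<Sum>q\<in>Poly_Mapping.keys y.
     scale (Poly_Mapping.lookup x p * Poly_Mapping.lookup y q * \<delta> ^ loops p q)
       (basis (comp_partition q p)))"

definition star :: "lin_partition \<Rightarrow> lin_partition" where
  "star x = (\<Sum>p\<in>Poly_Mapping.keys x. scale (cnj (Poly_Mapping.lookup x p)) (basis (flip_partition p)))"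


section \<open>Linear categories of partitions\<close>

definition id_part :: lin_partition where
  "id_part = basis {{Upper 1, Lower 1}}"

definition pair_part :: lin_partition where
  "pair_part = basis {{Lower 1, Lower 2}}"

definition linear_category :: "complex \<Rightarrow> (nat \<Rightarrow> nat \<Rightarrow> lin_partition set) \<Rightarrow> bool" where
  "linear_category \<delta> K \<longleftrightarrow>
     (\<forall>k l. K k l \<subseteq> Part k l \<and> part.subspace (K k l)) \<and>
     id_part \<in> K 1 1 \<and> pair_part \<in> K 0 2 \<and>
     (\<forall>k l k' l'. \<forall>x\<in>K k l. \<forall>y\<in>K k' l'. tensor k l x y \<in> K (k + k') (l + l')) \<and>
     (\<forall>k l m. \<forall>x\<in>K k l. \<forall>y\<in>K l m. composite \<delta> y x \<in> K k m) \<and>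
     (\<forall>k l. \<forall>x\<in>K k l. star x \<in> K l k)"

text \<open>
  A generator \<open>x \<in> Part k l\<close> is given as the triple \<open>(k, l, x)\<close>, since the element \<open>0\<close> does not
  determine \<open>k\<close> and \<open>l\<close>.
\<close>

definition generated ::
  "complex \<Rightarrow> (nat \<times> nat \<times> lin_partition) set \<Rightarrow> nat \<Rightarrow> nat \<Rightarrow> lin_partition set" where
  "generated \<delta> G k l =
     \<Inter>{K k l | K. linear_category \<delta> K \<and> (\<forall>(i, j, x)\<in>G. x \<in> K i j)}"

definition easy :: "(nat \<Rightarrow> nat \<Rightarrow> lin_partition set) \<Rightarrow> bool" where
  "easy K \<longleftrightarrow> (\<forall>k l. \<exists>C\<subseteq>Partitions k l. K k l = part.span (basis ` C))"


section \<open>The maps \<open>\<B>\<close> and \<open>\<V>\<close>\<close>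

text \<open>
  Multilinear expansion over the blocks of \<open>p\<close>: \<open>S\<close> is the set of those blocks for which the
  second summand, \<open>(-1)\<^sup>m\<close> times the \<open>m\<close> singletons, is chosen.
\<close>

definition B_partition :: "partition \<Rightarrow> lin_partition" where
  "B_partition p = (\<Sum>S\<in>Pow p.
     scale (\<Prod>b\<in>S. (-1) ^ card b) (basis ((p - S) \<union> (\<lambda>x. {x}) ` \<Union>S)))"

definition B_map :: "lin_partition \<Rightarrow> lin_partition" where
  "B_map x = (\<Sum>p\<in>Poly_Mapping.keys x. scale (Poly_Mapping.lookup x p) (B_partition p))"

text \<open>
  The sign \<open>\<plusminus>\<close> is a real number \<open>s \<in> {1, -1}\<close>; the parameter is \<open>\<delta>\<close>, not the loop parameter
  \<open>\<delta> - 1\<close> of the space in which \<open>\<upsilon>\<close> lives.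
\<close>

definition upsilon :: "real \<Rightarrow> real \<Rightarrow> lin_partition" where
  "upsilon \<delta> s = id_part
     - scale (of_real (1 / (\<delta> - 1) * (1 + s * (1 / sqrt \<delta>)))) (basis {{Upper 1}, {Lower 1}})"

primrec tensor_power :: "lin_partition \<Rightarrow> nat \<Rightarrow> lin_partition" where
  "tensor_power x 0 = basis {}"
| "tensor_power x (Suc n) = tensor n n (tensor_power x n) x"

definition V_map :: "real \<Rightarrow> real \<Rightarrow> nat \<Rightarrow> nat \<Rightarrow> lin_partition \<Rightarrow> lin_partition" where
  "V_map \<delta> s k l x =
     composite (of_real (\<delta> - 1)) (tensor_power (upsilon \<delta> s) l)
       (composite (of_real (\<delta> - 1)) (B_map x) (tensor_power (upsilon \<delta> s) k))"

definition aaa :: lin_partition where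
  "aaa = basis {{Lower 1, Lower 2, Lower 3}}"

definition aaaa :: lin_partition where
  "aaaa = basis {{Lower 1, Lower 2, Lower 3, Lower 4}}"


section \<open>Well-definedness\<close>

lemma flip_flip [simp]: "flip_point (flip_point x) = x"
  by (cases x) auto

lemma partition_on_image:
  assumes "partition_on A p" "inj_on f A"
  shows "partition_on (f ` A) ((`) f ` p)"
proof -
  have "{} \<notin> (`) f ` p" using assms(1) by (auto simp: partition_on_def)
  then show ?thesis using partition_on_inj_image[OF assms] by simp
qed

lemma flip_partition_in:
  assumes "p \<in> Partitions k l"
  shows "flip_partition p \<in> Partitions l k"
proof -
  have "flip_point ` points k l = points l k"
    by (auto simp: points_def image_Un image_image)
  moreover have "inj_on flip_point (points k l)"
    by (metis flip_flip inj_onI)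
  ultimately show ?thesis
    using partition_on_image[of "points k l" p flip_point] assms
    by (simp add: Partitions_def flip_partition_def)
qed

lemma tensor_partition_in:
  assumes "p \<in> Partitions k l" "q \<in> Partitions k' l'"
  shows "tensor_partition k l p q \<in> Partitions (k + k') (l + l')"
proof -
  let ?f = "shift_point k l"
  have inj: "inj_on ?f X" for X
    by (rule inj_onI, rename_tac x y, case_tac x; case_tac y) auto
  have q: "partition_on (?f ` points k' l') ((`) ?f ` q)"
    using partition_on_image[OF _ inj] assms(2) by (auto simp: Partitions_def)
  have im: "{n + 1..n + m} = (+) n ` {1..m}" for n m :: nat
    by (simp add: add.commute)
  have f: "?f ` points k' l' = Upper ` {k + 1..k + k'} \<union> Lower ` {l + 1..l + l'}"
    unfolding im points_def image_Un image_image by simp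
  have disj: "points k l \<inter> ?f ` points k' l' = {}"
    unfolding f by (auto simp: points_def)
  have split: "{1..a + b} = {1..a} \<union> {a + 1..a + b}" for a b :: nat
    by auto
  have un: "points (k + k') (l + l') = points k l \<union> ?f ` points k' l'"
    unfolding f unfolding points_def split[of k k'] split[of l l'] image_Un by blast
  have p: "partition_on (points k l) p" using assms(1) by (simp add: Partitions_def)
  show ?thesis
    unfolding Partitions_def mem_Collect_eq un tensor_partition_def
  proof (rule partition_onI)
    show "\<Union> (p \<union> (`) ?f ` q) = points k l \<union> ?f ` points k' l'"
      using p q by (auto simp: partition_on_def)
    show "{} \<notin> p \<union> (`) ?f ` q"
      using p q by (auto simp: partition_on_def)
  next
    fix a b assume ab: "a \<in> p \<union> (`) ?f ` q" "b \<in> p \<union> (`) ?f ` q" "a \<noteq> b"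
    have mixed: "disjnt c d" if "c \<in> p" "d \<in> (`) ?f ` q" for c d
    proof -
      have "c \<subseteq> points k l" "d \<subseteq> ?f ` points k' l'"
        using that partition_onD1[OF p] partition_onD1[OF q] by blast+
      with disj show ?thesis by (auto simp: disjnt_def)
    qed
    from ab(1,2) consider "a \<in> p" "b \<in> p" | "a \<in> p" "b \<in> (`) ?f ` q"
      | "b \<in> p" "a \<in> (`) ?f ` q" | "a \<in> (`) ?f ` q" "b \<in> (`) ?f ` q"
      by (elim UnE)
    then show "disjnt a b"
    proof cases
      case 1
      then show ?thesis using pairwiseD[OF partition_onD2[OF p]] ab(3) by blast
    next
      case 2
      then show ?thesis by (rule mixed)
    next
      case 3
      then show ?thesis using mixed disjnt_sym by blast
    next
      case 4
      then show ?thesis using pairwiseD[OF partition_onD2[OF q] _ _ ab(3)] by simp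
    qed
  qed
qed

lemma equiv_linked: "equiv (\<Union>(stack p q)) ((linked p q)\<^sup>+)"
proof (rule equivI)
  show "(linked p q)\<^sup>+ \<subseteq> \<Union>(stack p q) \<times> \<Union>(stack p q)"
    by (rule trancl_subset_Sigma) (auto simp: linked_def)
  show "refl_on (\<Union>(stack p q)) ((linked p q)\<^sup>+)"
    by (auto simp: refl_on_def linked_def intro!: r_into_trancl)
  show "sym ((linked p q)\<^sup>+)"
    by (rule sym_trancl) (auto simp: linked_def sym_def)
qed (rule trans_trancl)

lemma components_partition:
  assumes "p \<in> Partitions k l" "q \<in> Partitions l m"
  shows "partition_on (Top ` {1..k} \<union> Mid ` {1..l} \<union> Bot ` {1..m}) (components p q)"
proof -
  have "\<Union>(stack p q) = upper_half ` \<Union>p \<union> lower_half ` \<Union>q"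
    by (auto simp: stack_def)
  also have "\<dots> = upper_half ` points k l \<union> lower_half ` points l m"
    using assms by (simp add: Partitions_def partition_on_def)
  also have "\<dots> = Top ` {1..k} \<union> Mid ` {1..l} \<union> Bot ` {1..m}"
    by (auto simp: points_def image_Un image_image)
  finally show ?thesis
    unfolding components_def using partition_on_quotient[OF equiv_linked] by metis
qed

lemma comp_partition_in:
  assumes "p \<in> Partitions k l" "q \<in> Partitions l m"
  shows "comp_partition q p \<in> Partitions k m"
proof -
  have "x \<in> outer -` (Top ` {1..k} \<union> Mid ` {1..l} \<union> Bot ` {1..m}) \<longleftrightarrow> x \<in> points k m" for x
    by (cases x) (auto simp: points_def)
  then have "outer -` (Top ` {1..k} \<union> Mid ` {1..l} \<union> Bot ` {1..m}) = points k m"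
    by blast
  then show ?thesis
    using partition_on_vimage[OF components_partition[OF assms], of outer]
    by (simp add: Partitions_def comp_partition_def)
qed

lemma subspace_Part: "part.subspace (Part k l)"
proof (rule part.subspaceI)
  show "x + y \<in> Part k l" if "x \<in> Part k l" "y \<in> Part k l" for x y
    using that keys_add[of x y] by (auto simp: Part_def)
qed (auto simp: Part_def in_keys_iff)

lemma basis_in_Part: "p \<in> Partitions k l \<Longrightarrow> basis p \<in> Part k l"
  by (simp add: Part_def basis_def)

lemma linear_category_Part: "linear_category \<delta> Part"
proof -
  note sub = part.subspace_sum[OF subspace_Part] part.subspace_scale[OF subspace_Part]
  have "tensor k l x y \<in> Part (k + k') (l + l')" if "x \<in> Part k l" "y \<in> Part k' l'" for k l k' l' x y
    unfolding tensor_def using that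
    by (intro sub basis_in_Part tensor_partition_in) (auto simp: Part_def)
  moreover have "composite \<delta> y x \<in> Part k m" if "x \<in> Part k l" "y \<in> Part l m" for k l m x y
    unfolding composite_def using that
    by (intro sub basis_in_Part comp_partition_in[of _ k l _ m]) (auto simp: Part_def)
  moreover have "star x \<in> Part l k" if "x \<in> Part k l" for k l x
    unfolding star_def using that
    by (intro sub basis_in_Part flip_partition_in) (auto simp: Part_def)
  moreover have "points 1 1 = {Upper 1, Lower 1}" "points 0 2 = {Lower 1, Lower 2}"
    by (auto simp: points_def atLeastAtMost_iff le_Suc_eq numeral_2_eq_2)
  then have "{{Upper 1, Lower 1}} \<in> Partitions 1 1" "{{Lower 1, Lower 2}} \<in> Partitions 0 2"
    unfolding Partitions_def by (simp_all add: partition_on_space)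
  then have "id_part \<in> Part 1 1" "pair_part \<in> Part 0 2"
    unfolding id_part_def pair_part_def by (simp_all only: basis_in_Part)
  ultimately show ?thesis
    unfolding linear_category_def using subspace_Part by (intro conjI allI ballI) simp_all
qed

lemma linear_category_generated:
  assumes "\<And>k l x. (k, l, x) \<in> G \<Longrightarrow> x \<in> Part k l"
  shows "linear_category \<delta> (generated \<delta> G)"
proof -
  have "linear_category \<delta> Part \<and> (\<forall>(i, j, x)\<in>G. x \<in> Part i j)"
    using assms linear_category_Part by auto
  then have le: "generated \<delta> G k l \<subseteq> Part k l" for k l
    by (auto simp: generated_def)
  have mem: "x \<in> generated \<delta> G k l \<longleftrightarrow>
      (\<forall>K. linear_category \<delta> K \<and> (\<forall>(i, j, x)\<in>G. x \<in> K i j) \<longrightarrow> x \<in> K k l)" for k l x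
    by (auto simp: generated_def)
  have "part.subspace (generated \<delta> G k l)" for k l
    unfolding generated_def by (rule part.subspace_Inter) (auto simp: linear_category_def)
  moreover have "id_part \<in> generated \<delta> G 1 1" "pair_part \<in> generated \<delta> G 0 2"
    unfolding mem by (simp_all add: linear_category_def)
  moreover have "tensor k l x y \<in> generated \<delta> G (k + k') (l + l')"
    if "x \<in> generated \<delta> G k l" "y \<in> generated \<delta> G k' l'" for k l k' l' x y
    using that unfolding mem by (simp add: linear_category_def)
  moreover have "composite \<delta> y x \<in> generated \<delta> G k m"
    if "x \<in> generated \<delta> G k l" "y \<in> generated \<delta> G l m" for k l m x y
    using that unfolding mem linear_category_def by blast
  moreover have "star x \<in> generated \<delta> G l k" if "x \<in> generated \<delta> G k l" for k l x
    using that unfolding mem by (simp add: linear_category_def)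
  ultimately show ?thesis
    unfolding linear_category_def[of _ "generated \<delta> G"] using le
    by (intro conjI allI ballI)
qed

lemma generated_least:
  assumes "linear_category \<delta> K" "\<And>i j x. (i, j, x) \<in> G \<Longrightarrow> x \<in> K i j"
  shows "generated \<delta> G k l \<subseteq> K k l"
proof -
  have "K k l \<in> {K k l | K. linear_category \<delta> K \<and> (\<forall>(i, j, x)\<in>G. x \<in> K i j)}"
    using assms by blast
  then show ?thesis
    unfolding generated_def by (rule Inter_lower)
qed

lemma B_partition_in_Part:
  assumes "p \<in> Partitions k l"
  shows "B_partition p \<in> Part k l"
  unfolding B_partition_def
proof (intro part.subspace_sum[OF subspace_Part] part.subspace_scale[OF subspace_Part] basis_in_Part)
  fix S assume S: "S \<in> Pow p"
  have p: "\<Union>p = points k l" "{} \<notin> p" and disj: "\<And>b c. b \<in> p \<Longrightarrow> c \<in> p \<Longrightarrow> b \<noteq> c \<Longrightarrow> disjnt b c"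
    using assms by (auto simp: Partitions_def partition_on_def pairwise_def)
  have sep: "x \<notin> b" if "b \<in> p - S" "x \<in> \<Union>S" for b x
    using that S disj[of b] by (auto simp: disjnt_iff)
  have "partition_on (points k l) ((p - S) \<union> (\<lambda>x. {x}) ` \<Union>S)"
  proof (rule partition_onI)
    have "\<Union>((p - S) \<union> (\<lambda>x. {x}) ` \<Union>S) = \<Union>(p - S) \<union> \<Union>S"
      by auto
    also have "\<dots> = \<Union>p"
      using S by (simp add: Un_absorb2 flip: Union_Un_distrib)
    finally show "\<Union>((p - S) \<union> (\<lambda>x. {x}) ` \<Union>S) = points k l"
      by (simp add: p)
    show "{} \<notin> (p - S) \<union> (\<lambda>x. {x}) ` \<Union>S"
      using p by auto
  next
    fix b c
    assume "b \<in> (p - S) \<union> (\<lambda>x. {x}) ` \<Union>S" "c \<in> (p - S) \<union> (\<lambda>x. {x}) ` \<Union>S" "b \<noteq> c"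
    then consider "b \<in> p - S" "c \<in> p - S"
      | x where "b \<in> p - S" "x \<in> \<Union>S" "c = {x}"
      | x where "c \<in> p - S" "x \<in> \<Union>S" "b = {x}"
      | x y where "b = {x}" "c = {y}"
      by (elim UnE imageE) simp_all
    then show "disjnt b c"
    proof cases
      case 1
      then show ?thesis using disj \<open>b \<noteq> c\<close> by blast
    next
      case 2
      then show ?thesis using sep[of b x] by simp
    next
      case 3
      then show ?thesis using sep[of c x] by simp
    next
      case 4
      then show ?thesis using \<open>b \<noteq> c\<close> by (simp add: disjnt_iff)
    qed
  qed
  then show "(p - S) \<union> (\<lambda>x. {x}) ` \<Union>S \<in> Partitions k l"
    by (simp add: Partitions_def)
qed

lemma V_map_in_Part:
  assumes "x \<in> Part k l"
  shows "V_map \<delta> s k l x \<in> Part k l"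
proof -
  note sub = part.subspace_sum[OF subspace_Part] part.subspace_scale[OF subspace_Part]
    part.subspace_diff[OF subspace_Part]
  have cat: "tensor k l x y \<in> Part (k + k') (l + l')" if "x \<in> Part k l" "y \<in> Part k' l'"
    for k l k' l' x y
    using linear_category_Part that unfolding linear_category_def by blast
  have composite: "composite \<delta>' y x \<in> Part k m" if "x \<in> Part k l" "y \<in> Part l m" for \<delta>' k l m x y
    using linear_category_Part that unfolding linear_category_def by blast
  have "{{Upper 1}, {Lower 1}} \<in> Partitions 1 1"
    by (auto simp: Partitions_def points_def partition_on_def pairwise_def)
  then have u: "upsilon \<delta> s \<in> Part 1 1"
    unfolding upsilon_def using linear_category_Part
    by (intro sub basis_in_Part) (simp_all add: linear_category_def)
  have tp: "tensor_power (upsilon \<delta> s) n \<in> Part n n" for n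
  proof (induction n)
    case 0
    show ?case by (auto intro!: basis_in_Part simp: Partitions_def points_def partition_on_empty)
  next
    case (Suc n)
    then show ?case using cat[OF Suc u] by simp
  qed
  have "B_map x \<in> Part k l"
    unfolding B_map_def using assms by (intro sub B_partition_in_Part) (auto simp: Part_def)
  then show ?thesis
    unfolding V_map_def using composite tp by blast
qed

end

theory Submission
  imports Defs
begin

text \<open>
  For \<open>\<delta> = n\<close> integral, the partitions span the \<open>S\<^sub>n\<close>-invariant tensors over \<open>\<complex>\<^sup>n\<close>, and \<open>\<V>\<close> moves them
  to the standard representation, identified orthogonally with \<open>\<complex>\<^bsup>n-1\<^esup>\<close>. There \<open>S\<^bsub>n-1\<^esub>\<close> permutes
  the coordinates, while a transposition involving the remaining label acts as the orthogonal
  reflection \<open>x \<mapsto> x - \<langle>w, x\<rangle> w\<close> for some \<open>w\<close> with \<open>\<langle>w, w\<rangle> = 2\<close>. This survives for arbitrary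
  \<open>\<delta>\<close> if a partition is read as the function of labelings of its points that tests constancy on
  blocks, and contraction as a sum over \<open>N = \<delta> - 1\<close> labels, which makes sense for complex \<open>N\<close> because
  only eventually constant functions are summed. The elements invariant under the
  reflection at all points form a linear category containing \<open>\<V>\<close> of every one-block partition.
  If the category generated by such an element with \<open>l \<ge> 3\<close> points were easy, it would contain the
  partition with the only non-singleton block \<open>{1', 2'}\<close>, which occurs in the generator but is not
  invariant.
\<close>

section \<open>Summation over labels\<close>

definition indep :: "'a \<Rightarrow> (('a \<Rightarrow> nat) \<Rightarrow> complex) \<Rightarrow> bool" where
  "indep v F \<longleftrightarrow> (\<forall>f i. F (f(v := i)) = F f)"

lemma indepD: "indep v F \<Longrightarrow> F (f(v := i)) = F f"
  by (simp add: indep_def)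

lemma indep_const: "indep v (\<lambda>f. c)"
  by (simp add: indep_def)

lemma indep_mult: "indep v F \<Longrightarrow> indep v G \<Longrightarrow> indep v (\<lambda>f. F f * G f)"
  by (simp add: indep_def)

lemma indep_diff: "indep v F \<Longrightarrow> indep v G \<Longrightarrow> indep v (\<lambda>f. F f - G f)"
  by (simp add: indep_def)

lemma prod_list_cong:
  fixes A B :: "'a \<Rightarrow> complex"
  shows "(\<And>v. v \<in> set vs \<Longrightarrow> A v = B v) \<Longrightarrow> (\<Prod>v\<leftarrow>vs. A v) = (\<Prod>v\<leftarrow>vs. B v)"
  by (induction vs) simp_all

lemma indep_prod_list: "(\<And>u. u \<in> set us \<Longrightarrow> indep v (\<phi> u)) \<Longrightarrow> indep v (\<lambda>f. \<Prod>u\<leftarrow>us. \<phi> u f)"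
  by (induction us) (simp_all add: indep_def)

text \<open>\<open>None\<close> stands for the fixed label 0, which the reflection singles out.
  Comparing two points and comparing a point with the label 0 thus become one kind of atom.\<close>

fun label :: "('a \<Rightarrow> nat) \<Rightarrow> 'a option \<Rightarrow> nat" where
  "label f None = 0"
| "label f (Some v) = f v"

lemma label_upd: "x \<noteq> Some v \<Longrightarrow> label (f(v := i)) x = label f x"
  by (cases x) auto

text \<open>The algebra generated by equality tests. It contains the evaluations of all elements of
  \<open>Part k l\<close>, is closed under summation and reflection, and its members are eventually
  constant in each single variable.\<close>

inductive tame :: "(('a \<Rightarrow> nat) \<Rightarrow> complex) \<Rightarrow> bool" where
  tame_const: "tame (\<lambda>f. c)"
| tame_label: "tame (\<lambda>f. of_bool (label f x = label f y))"
| tame_add: "tame F \<Longrightarrow> tame G \<Longrightarrow> tame (\<lambda>f. F f + G f)"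
| tame_mult: "tame F \<Longrightarrow> tame G \<Longrightarrow> tame (\<lambda>f. F f * G f)"

lemma tame_eq: "tame (\<lambda>f. of_bool (f u = f v))"
  using tame_label[of "Some u" "Some v"] by simp

lemma tame_zero_label: "tame (\<lambda>f. of_bool (f v = 0))"
  using tame_label[of "Some v" None] by simp

lemma tame_diff:
  assumes "tame F" "tame G"
  shows "tame (\<lambda>f. F f - G f)"
  using tame_add[OF assms(1) tame_mult[OF tame_const[of "-1"] assms(2)]] by simp

lemma tame_sum: "(\<And>x. x \<in> S \<Longrightarrow> tame (F x)) \<Longrightarrow> tame (\<lambda>f. \<Sum>x\<in>S. F x f)"
  by (induction S rule: infinite_finite_induct) (auto intro: tame_const tame_add)

lemma tame_prod_list: "(\<And>x. x \<in> set xs \<Longrightarrow> tame (F x)) \<Longrightarrow> tame (\<lambda>f. \<Prod>x\<leftarrow>xs. F x f)"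
  by (induction xs) (auto intro: tame_const tame_mult)

lemma tame_ball:
  assumes "finite S" "\<And>x. x \<in> S \<Longrightarrow> tame (\<lambda>f. of_bool (P x f))"
  shows "tame (\<lambda>f. of_bool (\<forall>x\<in>S. P x f))"
  using assms
proof (induction S)
  case (insert x S)
  then show ?case
    using tame_mult[of "\<lambda>f. of_bool (P x f)" "\<lambda>f. of_bool (\<forall>x\<in>S. P x f)"]
    by (simp add: of_bool_conj)
qed (simp add: tame_const)

lemma tame_comp: "tame F \<Longrightarrow> tame (\<lambda>f. F (f \<circ> \<phi>))"
proof (induction F rule: tame.induct)
  case (tame_label x y)
  have "label (f \<circ> \<phi>) z = label f (map_option \<phi> z)" for f z
    by (cases z) auto
  then show ?case by (simp only: tame.tame_label)
qed (auto intro: tame.intros)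

text \<open>
  A tame function is, in each single variable \<open>v\<close>, a sum of terms \<open>A\<close> and \<open>A * of_bool (f v = \<dots>)\<close>
  with \<open>A\<close> independent of \<open>v\<close>; summation over \<open>v\<close>, and hence Fubini, is explicit on these.
\<close>

inductive split_at :: "'a \<Rightarrow> (('a \<Rightarrow> nat) \<Rightarrow> complex) \<Rightarrow> bool" for v where
  split_indep: "tame A \<Longrightarrow> indep v A \<Longrightarrow> split_at v A"
| split_eq: "tame A \<Longrightarrow> indep v A \<Longrightarrow> x \<noteq> Some v \<Longrightarrow>
    split_at v (\<lambda>f. A f * of_bool (f v = label f x))"
| split_add: "split_at v F \<Longrightarrow> split_at v G \<Longrightarrow> split_at v (\<lambda>f. F f + G f)"

lemma indep_label: "x \<noteq> Some v \<Longrightarrow> y \<noteq> Some v \<Longrightarrow> indep v (\<lambda>f. of_bool (label f x = label f y))"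
  by (simp add: indep_def label_upd)

lemma split_mult:
  assumes "split_at v F" "split_at v G"
  shows "split_at v (\<lambda>f. F f * G f)"
  using assms(1)
proof (induction F rule: split_at.induct)
  case A: (split_indep A)
  from assms(2) show ?case
  proof (induction G rule: split_at.induct)
    case (split_eq B x)
    then show ?case
      using split_at.split_eq[of "\<lambda>f. A f * B f" v x] A
      by (simp add: tame_mult indep_mult mult.assoc)
  next
    case (split_add F G)
    then show ?case
      using split_at.split_add by (simp add: distrib_left)
  qed (simp add: A split_at.split_indep tame_mult indep_mult)
next
  case A: (split_eq A x)
  from assms(2) show ?case
  proof (induction G rule: split_at.induct)
    case (split_indep B)
    then show ?case
      using split_at.split_eq[of "\<lambda>f. A f * B f" v x] A
      by (simp add: tame_mult indep_mult mult_ac)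
  next
    case (split_eq B y)
    \<comment> \<open>Two tests of \<open>f v\<close> amount to one such test together with a test
      independent of \<open>v\<close>, so the product keeps the normal form.\<close>
    let ?C = "\<lambda>f. A f * B f * of_bool (label f x = label f y)"
    have "(\<lambda>f. A f * of_bool (f v = label f x) * (B f * of_bool (f v = label f y)))
        = (\<lambda>f. ?C f * of_bool (f v = label f x))"
      by (auto simp: fun_eq_iff)
    moreover have "tame ?C" "indep v ?C"
      using A split_eq by (auto intro: tame.intros indep_mult indep_label)
    ultimately show ?case
      using split_at.split_eq[of ?C v x] A by simp
  next
    case (split_add F G)
    then show ?case
      using split_at.split_add by (simp add: distrib_left)
  qed
next
  case (split_add F G)
  then show ?case
    using split_at.split_add by (simp add: distrib_right)
qed

lemma tame_split: "tame F \<Longrightarrow> split_at v F"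
proof (induction F rule: tame.induct)
  case (tame_label x y)
  consider "x \<noteq> Some v" "y \<noteq> Some v" | "x = Some v" "y = Some v"
    | "x = Some v" "y \<noteq> Some v" | "x \<noteq> Some v" "y = Some v"
    by blast
  then show ?case
  proof cases
    case 1
    then show ?thesis by (simp add: split_indep indep_label tame.tame_label)
  next
    case 2
    then show ?thesis using split_indep[of "\<lambda>f. 1" v] by (simp add: indep_const tame_const)
  next
    case 3
    then show ?thesis
      using split_eq[OF tame_const indep_const, of y v 1] by simp
  next
    case 4
    then show ?thesis
      using split_eq[OF tame_const indep_const, of x v 1] by (simp add: eq_commute)
  qed
qed (auto intro: split_indep split_add split_mult tame_const indep_const)

section \<open>Eventually constant functions and their formal sums\<close>

definition eventually_const :: "(nat \<Rightarrow> complex) \<Rightarrow> bool" where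
  "eventually_const g \<longleftrightarrow> (\<exists>n. \<forall>i\<ge>n. g i = g n)"

lemma eventually_constE:
  assumes "eventually_const g" "eventually_const h"
  obtains n where "\<And>i. i \<ge> n \<Longrightarrow> g i = g n" "\<And>i. i \<ge> n \<Longrightarrow> h i = h n"
proof -
  obtain m n where "\<forall>i\<ge>m. g i = g m" "\<forall>i\<ge>n. h i = h n"
    using assms by (auto simp: eventually_const_def)
  then have "i \<ge> max m n \<Longrightarrow> g i = g (max m n) \<and> h i = h (max m n)" for i
    by (metis max.bounded_iff order_refl)
  then show ?thesis using that by blast
qed

lemma tame_eventually_const:
  assumes "tame F"
  shows "eventually_const (\<lambda>i. F (f(v := i)))"
  using tame_split[OF assms, of v]
proof (induction F rule: split_at.induct)
  case (split_eq A x)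
  then have "A (f(v := i)) * of_bool ((f(v := i)) v = label (f(v := i)) x)
      = A f * of_bool (i = label f x)" for i
    by (simp add: indepD label_upd)
  then show ?case
    by (auto simp del: fun_upd_apply simp: eventually_const_def intro!: exI[of _ "Suc (label f x)"])
next
  case (split_add F G)
  obtain n where n: "\<And>i. i \<ge> n \<Longrightarrow> F (f(v := i)) = F (f(v := n))"
      "\<And>i. i \<ge> n \<Longrightarrow> G (f(v := i)) = G (f(v := n))"
    using eventually_constE[OF split_add.IH] by blast
  show ?case
    unfolding eventually_const_def by (intro exI[of _ n] allI impI arg_cong2[of _ _ _ _ "(+)"] n)
qed (simp del: fun_upd_apply add: eventually_const_def indepD)

text \<open>
  The sum of \<open>g\<close> over \<open>N\<close> labels, for arbitrary complex \<open>N\<close>: labels \<open>i \<ge> n\<close>, on which \<open>g\<close> is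
  constant, have total mass \<open>N - n\<close>.
\<close>

definition lsum :: "complex \<Rightarrow> (nat \<Rightarrow> complex) \<Rightarrow> complex" where
  "lsum N g = (let n = (LEAST n. \<forall>i\<ge>n. g i = g n) in (\<Sum>i<n. g i) + (N - of_nat n) * g n)"

text \<open>Any threshold from which \<open>g\<close> is constant may replace the least one: each
  label passed over contributes \<open>c\<close> and lowers the remaining mass by one. Two functions
  can therefore be summed with a common threshold.\<close>

lemma lsum_eq:
  assumes "\<And>i. i \<ge> n \<Longrightarrow> g i = c"
  shows "lsum N g = (\<Sum>i<n. g i) + (N - of_nat n) * c"
proof -
  define m where "m = (LEAST n. \<forall>i\<ge>n. g i = g n)"
  have P: "\<forall>i\<ge>n. g i = g n" using assms by simp
  have "m \<le> n" unfolding m_def by (rule Least_le) (rule P)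
  have "\<forall>i\<ge>m. g i = g m" unfolding m_def by (rule LeastI) (rule P)
  then have gm: "g i = c" if "i \<ge> m" for i using that \<open>m \<le> n\<close> assms by (metis order_refl)
  have "{..<n} = {..<m} \<union> {m..<n}" using \<open>m \<le> n\<close> by auto
  then have "(\<Sum>i<n. g i) = (\<Sum>i<m. g i) + (\<Sum>i=m..<n. g i)"
    by (simp add: sum.union_disjoint ivl_disj_int)
  also have "(\<Sum>i=m..<n. g i) = of_nat (n - m) * c" using gm by simp
  finally show ?thesis
    using \<open>m \<le> n\<close> gm[of m]
    by (simp add: lsum_def Let_def m_def[symmetric] of_nat_diff algebra_simps)
qed

lemma lsum_const: "lsum N (\<lambda>i. c) = N * c"
  using lsum_eq[of 0 "\<lambda>i. c" c] by simp

lemma lsum_delta: "lsum N (\<lambda>i. h i * of_bool (i = k)) = h k"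
  using lsum_eq[of "Suc k" "\<lambda>i. h i * of_bool (i = k)" 0] by (simp add: of_bool_def if_distrib cong: if_cong)

lemma lsum_delta': "lsum N (\<lambda>i. h i * of_bool (k = i)) = h k"
  using lsum_delta[of N h k] by (simp add: eq_commute)

lemma lsum_add:
  assumes "eventually_const g" "eventually_const h"
  shows "lsum N (\<lambda>i. g i + h i) = lsum N g + lsum N h"
proof -
  obtain n where n: "\<And>i. i \<ge> n \<Longrightarrow> g i = g n" "\<And>i. i \<ge> n \<Longrightarrow> h i = h n"
    using eventually_constE[OF assms] by blast
  have "lsum N (\<lambda>i. g i + h i) = (\<Sum>i<n. g i + h i) + (N - of_nat n) * (g n + h n)"
    by (rule lsum_eq) (metis n)
  then show ?thesis
    by (simp only: lsum_eq[of n g, OF n(1)] lsum_eq[of n h, OF n(2)])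
      (simp add: sum.distrib algebra_simps)
qed

lemma lsum_cmult:
  assumes "eventually_const g"
  shows "lsum N (\<lambda>i. c * g i) = c * lsum N g"
proof -
  obtain n where n: "\<And>i. i \<ge> n \<Longrightarrow> g i = g n"
    using assms by (auto simp: eventually_const_def)
  have "lsum N (\<lambda>i. c * g i) = (\<Sum>i<n. c * g i) + (N - of_nat n) * (c * g n)"
    by (rule lsum_eq) (metis n)
  then show ?thesis
    by (simp only: lsum_eq[of n g, OF n]) (simp add: sum_distrib_left algebra_simps)
qed

lemma lsum_cnj:
  assumes "eventually_const g"
  shows "lsum (cnj N) (\<lambda>i. cnj (g i)) = cnj (lsum N g)"
proof -
  obtain n where n: "\<And>i. i \<ge> n \<Longrightarrow> g i = g n"
    using assms by (auto simp: eventually_const_def)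
  have "lsum (cnj N) (\<lambda>i. cnj (g i)) = (\<Sum>i<n. cnj (g i)) + (cnj N - of_nat n) * cnj (g n)"
    by (rule lsum_eq) (metis n)
  then show ?thesis
    using lsum_eq[of n g "g n" N, OF n] by simp
qed

text \<open>Contraction of the variable \<open>v\<close>. The result is again a function of full
  labelings, merely independent of \<open>v\<close>, so that contractions can be iterated without
  changing the type.\<close>

definition integ :: "complex \<Rightarrow> 'a \<Rightarrow> (('a \<Rightarrow> nat) \<Rightarrow> complex) \<Rightarrow> ('a \<Rightarrow> nat) \<Rightarrow> complex" where
  "integ N v F f = lsum N (\<lambda>i. F (f(v := i)))"

lemma integ_indep: "indep v A \<Longrightarrow> integ N v A = (\<lambda>f. N * A f)"
  by (simp add: integ_def indepD lsum_const fun_eq_iff)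

lemma integ_eq:
  assumes "indep v A" "x \<noteq> Some v"
  shows "integ N v (\<lambda>f. A f * of_bool (f v = label f x)) = A"
  using assms lsum_delta[of N "\<lambda>i. A f" "label f x" for f]
  by (simp add: integ_def indepD label_upd fun_eq_iff)

lemma integ_subst:
  "integ N v (\<lambda>f. A f * of_bool (f u = f v)) = (\<lambda>f. A (f(v := f u)))" if "u \<noteq> v"
  using that lsum_delta'[of N "\<lambda>i. A (f(v := i))" "f u" for f]
  by (simp add: integ_def fun_eq_iff)

lemma integ_add:
  assumes "tame F" "tame G"
  shows "integ N v (\<lambda>f. F f + G f) = (\<lambda>f. integ N v F f + integ N v G f)"
  by (simp add: integ_def fun_eq_iff lsum_add tame_eventually_const assms)

lemma integ_mult_indep:
  assumes "tame F" "indep v A"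
  shows "integ N v (\<lambda>f. A f * F f) = (\<lambda>f. A f * integ N v F f)"
  by (simp add: integ_def fun_eq_iff lsum_cmult tame_eventually_const assms indepD)

lemma integ_diff:
  assumes "tame F" "tame G"
  shows "integ N v (\<lambda>f. F f - G f) = (\<lambda>f. integ N v F f - integ N v G f)"
  using integ_add[OF assms(1) tame_mult[OF tame_const[of "-1"] assms(2)], of N v]
    integ_mult_indep[OF assms(2) indep_const[of v "-1"], of N]
  by simp

lemma indep_integ_same: "indep v (integ N v F)"
  by (simp add: indep_def integ_def)

lemma indep_integ: "indep u F \<Longrightarrow> indep u (integ N v F)"
proof (cases "u = v")
  case False
  assume F: "indep u F"
  have "F (f(u := i, v := j)) = F (f(v := j))" for f i j
    using indepD[OF F, of "f(v := j)" i] fun_upd_twist[OF False, of f i j] by simp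
  then show ?thesis by (simp add: indep_def integ_def)
qed (simp add: indep_integ_same)

lemma split_tame: "split_at v F \<Longrightarrow> tame F"
proof (induction F rule: split_at.induct)
  case (split_eq A x)
  then show ?case
    using tame_mult[OF _ tame_label[of "Some v" x]] by simp
qed (auto intro: tame_add)

lemma tame_integ:
  assumes "tame F"
  shows "tame (integ N v F)"
  using tame_split[OF assms, of v]
proof (induction F rule: split_at.induct)
  case (split_add F G)
  then show ?case by (simp add: integ_add split_tame tame_add)
qed (simp_all add: integ_indep integ_eq tame_mult tame_const)

text \<open>Fubini, read off from the normal form at \<open>v\<close>. The only delicate term is
  \<open>A * of_bool (f v = f u)\<close>, which tests the two variables against each other; both
  orders of summation reduce it to \<open>integ N u A\<close>.\<close>

lemma integ_commute:
  assumes "tame F"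
  shows "integ N u (integ N v F) = integ N v (integ N u F)"
proof (cases "u = v")
  case False
  show ?thesis
    using tame_split[OF assms, of v]
  proof (induction F rule: split_at.induct)
    case (split_indep A)
    then show ?case
      using integ_mult_indep[OF split_indep(1) indep_const[of u N], of N]
      by (simp add: integ_indep indep_integ)
  next
    case (split_eq A x)
    show ?case
    proof (cases "x = Some u")
      case True
      have "integ N v (\<lambda>f. A (f(u := f v))) = integ N u A"
        using False indepD[OF split_eq(2)] by (simp add: integ_def fun_eq_iff fun_upd_twist)
      then show ?thesis
        using integ_eq[OF split_eq(2,3)] integ_subst[of v u N A] False True by simp
    next
      case x: False
      have "integ N u (\<lambda>f. A f * of_bool (f v = label f x))
          = (\<lambda>f. integ N u A f * of_bool (f v = label f x))"
        using integ_mult_indep[OF split_eq(1), of u "\<lambda>f. of_bool (f v = label f x)" N] x False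
        by (simp add: mult.commute indep_def label_upd)
      then show ?thesis
        using split_eq by (simp add: integ_eq indep_integ)
    qed
  next
    case (split_add F G)
    then show ?case by (simp add: integ_add split_tame tame_integ)
  qed
qed simp

lemma integ_cnj:
  assumes "tame F"
  shows "integ (cnj N) v (\<lambda>f. cnj (F f)) = (\<lambda>f. cnj (integ N v F f))"
  by (simp add: integ_def fun_eq_iff lsum_cnj tame_eventually_const assms)

lemma integ_comp:
  assumes "inj \<phi>"
  shows "integ N (\<phi> v) (\<lambda>f. F (f \<circ> \<phi>)) = (\<lambda>f. integ N v F (f \<circ> \<phi>))"
proof -
  have "f(\<phi> v := i) \<circ> \<phi> = (f \<circ> \<phi>)(v := i)" for f :: "_ \<Rightarrow> nat" and i
    using assms by (auto simp: fun_eq_iff inj_eq)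
  then show ?thesis by (intro ext) (simp add: integ_def)
qed

definition integs :: "complex \<Rightarrow> 'a list \<Rightarrow> (('a \<Rightarrow> nat) \<Rightarrow> complex) \<Rightarrow> ('a \<Rightarrow> nat) \<Rightarrow> complex" where
  "integs N vs F = foldr (integ N) vs F"

lemma integs_simps [simp]:
  "integs N [] F = F" "integs N (v # vs) F = integ N v (integs N vs F)"
  by (simp_all add: integs_def)

lemma tame_integs: "tame F \<Longrightarrow> tame (integs N vs F)"
  by (induction vs) (auto intro: tame_integ)

lemma integ_integs:
  assumes "tame F"
  shows "integ N u (integs N vs F) = integs N vs (integ N u F)"
proof (induction vs)
  case (Cons v vs)
  then show ?case
    using integ_commute[OF tame_integs[OF assms, of N vs], of N u v] by simp
qed simp

lemma integs_add:
  assumes "tame F" "tame G"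
  shows "integs N vs (\<lambda>f. F f + G f) = (\<lambda>f. integs N vs F f + integs N vs G f)"
  by (induction vs) (simp_all add: integ_add tame_integs assms)

lemma integs_cmult:
  assumes "tame F"
  shows "integs N vs (\<lambda>f. c * F f) = (\<lambda>f. c * integs N vs F f)"
  by (induction vs) (simp_all add: integ_mult_indep indep_const tame_integs assms)

lemma integs_sum:
  assumes "\<And>x. x \<in> S \<Longrightarrow> tame (F x)"
  shows "integs N vs (\<lambda>f. \<Sum>x\<in>S. F x f) = (\<lambda>f. \<Sum>x\<in>S. integs N vs (F x) f)"
  using assms
proof (induction S rule: infinite_finite_induct)
  case (insert x S)
  then show ?case by (simp add: integs_add tame_sum)
qed (use integs_cmult[OF tame_const[of 0], of N vs 0] in simp_all)

text \<open>Stated for an abstract operator so as to serve both summation and reflection: each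
  operator acts on its own factor and treats the others as scalars. In the induction,
  \<open>B\<close> carries along the factors whose operators are applied later.\<close>

lemma foldr_leg_prod:
  fixes op :: "'a \<Rightarrow> (('a \<Rightarrow> nat) \<Rightarrow> complex) \<Rightarrow> ('a \<Rightarrow> nat) \<Rightarrow> complex"
  assumes op_mult: "\<And>v A F. tame F \<Longrightarrow> indep v A \<Longrightarrow> op v (\<lambda>f. A f * F f) = (\<lambda>f. A f * op v F f)"
    and op_tame: "\<And>v F. tame F \<Longrightarrow> tame (op v F)"
    and op_indep: "\<And>u v F. indep u F \<Longrightarrow> u \<noteq> v \<Longrightarrow> indep u (op v F)"
    and "distinct vs" "\<And>v. v \<in> set vs \<Longrightarrow> tame (\<phi> v)"
    and "\<And>u v. u \<in> set vs \<Longrightarrow> v \<in> set vs \<Longrightarrow> u \<noteq> v \<Longrightarrow> indep u (\<phi> v)"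
    and "tame B" "\<And>v. v \<in> set vs \<Longrightarrow> indep v B"
  shows "foldr op vs (\<lambda>f. (\<Prod>v\<leftarrow>vs. \<phi> v f) * B f) = (\<lambda>f. (\<Prod>v\<leftarrow>vs. op v (\<phi> v) f) * B f)"
  using assms(4-)
proof (induction vs arbitrary: B)
  case (Cons v vs)
  have "foldr op vs (\<lambda>f. (\<Prod>u\<leftarrow>vs. \<phi> u f) * (\<phi> v f * B f))
      = (\<lambda>f. (\<Prod>u\<leftarrow>vs. op u (\<phi> u) f) * (\<phi> v f * B f))"
    using Cons.prems by (intro Cons.IH) (auto intro!: tame_mult indep_mult)
  moreover have "op v (\<lambda>f. ((\<Prod>u\<leftarrow>vs. op u (\<phi> u) f) * B f) * \<phi> v f)
      = (\<lambda>f. ((\<Prod>u\<leftarrow>vs. op u (\<phi> u) f) * B f) * op v (\<phi> v) f)"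
    using Cons.prems by (intro op_mult indep_mult indep_prod_list op_indep) auto
  ultimately show ?case by (simp add: mult_ac)
qed simp

lemma integs_prod:
  assumes "distinct vs" "\<And>v. v \<in> set vs \<Longrightarrow> tame (\<phi> v)"
    and "\<And>u v. u \<in> set vs \<Longrightarrow> v \<in> set vs \<Longrightarrow> u \<noteq> v \<Longrightarrow> indep u (\<phi> v)"
  shows "integs N vs (\<lambda>f. \<Prod>v\<leftarrow>vs. \<phi> v f) = (\<lambda>f. \<Prod>v\<leftarrow>vs. integ N v (\<phi> v) f)"
  using foldr_leg_prod[of "integ N" vs \<phi> "\<lambda>f. 1"] assms
  by (simp add: integs_def integ_mult_indep tame_integ indep_integ tame_const indep_const)


section \<open>A reflection acting on every point\<close>

locale reflection =
  fixes N a t :: complex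
  \<comment> \<open>For the theorem, \<open>N = \<delta> - 1\<close>, \<open>t = - s / sqrt \<delta>\<close>, and \<open>a\<close> is the coefficient in \<open>upsilon \<delta> s\<close>.\<close>
  assumes real: "cnj N = N" "cnj a = a" "cnj t = t"
    and aN: "a * N = 1 - t" and at: "a * (1 + t) = t\<^sup>2" and tN: "t\<^sup>2 * (1 + N) = 1"
begin

text \<open>The difference of the two vectors that the reflection is to interchange,
  \<open>\<lambda>i. of_bool (i = 0) - a\<close> and the constant \<open>- t\<close>.\<close>

definition w :: "nat \<Rightarrow> complex" where
  "w i = of_bool (i = 0) + (t - a)"

text \<open>No normalizing factor appears because \<open>w\<close> has squared length 2, by
  \<open>lsum_ww\<close>.\<close>

definition reflect :: "'a \<Rightarrow> (('a \<Rightarrow> nat) \<Rightarrow> complex) \<Rightarrow> ('a \<Rightarrow> nat) \<Rightarrow> complex" where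
  "reflect v F = (\<lambda>f. F f - w (f v) * integ N v (\<lambda>f. w (f v) * F f) f)"

lemma t_nonzero: "t \<noteq> 0"
  using tN by auto

lemma lsum_w:
  "lsum N (\<lambda>i. w i * h i) = h 0 + (t - a) * lsum N h" if "eventually_const h"
proof -
  have "eventually_const (\<lambda>i. h i * of_bool (i = 0))" "eventually_const (\<lambda>i. (t - a) * h i)"
    using that by (auto simp: eventually_const_def intro: exI[of _ 1])
  then have "lsum N (\<lambda>i. h i * of_bool (i = 0) + (t - a) * h i) = h 0 + (t - a) * lsum N h"
    using that by (simp add: lsum_add lsum_delta lsum_cmult)
  moreover have "w i * h i = h i * of_bool (i = 0) + (t - a) * h i" for i
    by (simp add: w_def algebra_simps)
  ultimately show ?thesis by simp
qed

lemma lsum_w1: "lsum N w = 1 / t"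
proof -
  \<comment> \<open>Multiplying by \<open>t\<close> avoids division: by \<open>aN\<close> the
    right-hand side becomes \<open>t^2 * (1 + N)\<close>.\<close>
  have "t * lsum N (\<lambda>i. w i * 1) = t + t * ((t - a) * N)"
    by (subst lsum_w) (auto simp: eventually_const_def lsum_const algebra_simps)
  also have "\<dots> = 1"
    using aN tN by algebra
  finally show ?thesis using t_nonzero by (simp add: field_simps)
qed

text \<open>Multiplied by \<open>t\<close>, the sum is \<open>2 * t + (t^2 - a * (1 + t))\<close>,
  and the bracket vanishes by \<open>at\<close>.\<close>

lemma lsum_ww: "lsum N (\<lambda>i. w i * w i) = 2"
proof -
  have "eventually_const w"
    by (auto simp: eventually_const_def w_def intro: exI[of _ 1])
  then have "lsum N (\<lambda>i. w i * w i) = 1 + (t - a) + (t - a) * (1 / t)"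
    by (simp add: lsum_w lsum_w1 w_def[of 0])
  then have "t * lsum N (\<lambda>i. w i * w i) = t * (1 + (t - a)) + (t - a)"
    using t_nonzero by (simp add: distrib_left)
  also have "\<dots> = t * 2"
    using at by algebra
  finally show ?thesis using t_nonzero by simp
qed

lemma tame_w: "tame (\<lambda>f. w (f v))"
  unfolding w_def by (intro tame_add tame_const tame_zero_label)

lemma indep_w: "u \<noteq> v \<Longrightarrow> indep u (\<lambda>f. w (f v))"
  by (simp add: indep_def)

lemma tame_reflect: "tame F \<Longrightarrow> tame (reflect v F)"
  unfolding reflect_def by (intro tame_diff tame_mult tame_integ tame_w)

lemma indep_reflect: "indep u F \<Longrightarrow> u \<noteq> v \<Longrightarrow> indep u (reflect v F)"
  unfolding reflect_def by (intro indep_diff indep_mult indep_integ indep_w)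

lemma reflect_add:
  assumes "tame F" "tame G"
  shows "reflect v (\<lambda>f. F f + G f) = (\<lambda>f. reflect v F f + reflect v G f)"
  using integ_add[OF tame_mult[OF tame_w assms(1)] tame_mult[OF tame_w assms(2)], of N v v v]
  by (simp add: reflect_def fun_eq_iff algebra_simps)

lemma reflect_mult_indep:
  assumes "tame F" "indep v A"
  shows "reflect v (\<lambda>f. A f * F f) = (\<lambda>f. A f * reflect v F f)"
  using integ_mult_indep[OF tame_mult[OF tame_w assms(1)] assms(2), of N v]
  by (simp add: reflect_def fun_eq_iff algebra_simps)

lemma reflect_diff:
  assumes "tame F" "tame G"
  shows "reflect v (\<lambda>f. F f - G f) = (\<lambda>f. reflect v F f - reflect v G f)"
  using reflect_add[OF assms(1) tame_mult[OF tame_const[of "-1"] assms(2)], of v]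
    reflect_mult_indep[OF assms(2) indep_const[of v "-1"]]
  by simp

text \<open>The vector \<open>w\<close> and the number of labels are real; this yields closure under
  the antilinear involution.\<close>

lemma reflect_cnj:
  assumes "tame F"
  shows "reflect v (\<lambda>f. cnj (F f)) = (\<lambda>f. cnj (reflect v F f))"
proof -
  have "cnj (w i) = w i" for i by (simp add: w_def real)
  then show ?thesis
    using integ_cnj[OF tame_mult[OF tame_w assms], of N v v]
    by (simp add: reflect_def fun_eq_iff real)
qed

lemma reflect_comp:
  assumes "inj \<phi>"
  shows "reflect (\<phi> v) (\<lambda>f. F (f \<circ> \<phi>)) = (\<lambda>f. reflect v F (f \<circ> \<phi>))"
  using integ_comp[OF assms, of N v "\<lambda>f. w (f v) * F f"]
  by (simp add: reflect_def fun_eq_iff)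

text \<open>Since \<open>w\<close> has squared length 2, reflecting changes the sign of the
  component \<open>?P\<close> along \<open>w\<close>, so the second reflection undoes the
  first.\<close>

lemma reflect_involution:
  assumes "tame F"
  shows "reflect v (reflect v F) = F"
proof -
  let ?P = "integ N v (\<lambda>f. w (f v) * F f)"
  have "integ N v (\<lambda>f. w (f v) * reflect v F f)
      = integ N v (\<lambda>f. w (f v) * F f - ?P f * (w (f v) * w (f v)))"
    by (simp add: reflect_def algebra_simps)
  also have "\<dots> = (\<lambda>f. ?P f - ?P f * integ N v (\<lambda>f. w (f v) * w (f v)) f)"
    by (simp add: integ_diff integ_mult_indep tame_mult tame_w tame_integ assms indep_integ_same)
  also have "\<dots> = (\<lambda>f. - ?P f)"
    by (simp add: integ_def lsum_ww)
  finally show ?thesis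
    by (simp add: reflect_def fun_eq_iff)
qed

text \<open>Both sides are the pairing of \<open>F\<close> and \<open>G\<close> minus the product of
  their components along \<open>w\<close>, an expression symmetric in \<open>F\<close> and
  \<open>G\<close>.\<close>

lemma integ_reflect_symmetric:
  assumes "tame F" "tame G"
  shows "integ N v (\<lambda>f. reflect v F f * G f) = integ N v (\<lambda>f. F f * reflect v G f)"
proof -
  have half: "integ N v (\<lambda>f. reflect v F f * G f) = (\<lambda>f. integ N v (\<lambda>f. F f * G f) f
      - integ N v (\<lambda>f. w (f v) * F f) f * integ N v (\<lambda>f. w (f v) * G f) f)"
    if "tame F" "tame G" for F G
  proof -
    let ?P = "integ N v (\<lambda>f. w (f v) * F f)"
    have "integ N v (\<lambda>f. reflect v F f * G f)
        = integ N v (\<lambda>f. F f * G f - ?P f * (w (f v) * G f))"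
      by (simp add: reflect_def algebra_simps)
    then show ?thesis
      by (simp add: integ_diff integ_mult_indep tame_mult tame_w tame_integ that indep_integ_same)
  qed
  show ?thesis
    using half[OF assms] half[OF assms(2,1)] by (simp add: mult.commute)
qed

text \<open>The operators concern different variables, so this reduces to Fubini.\<close>

lemma reflect_integ:
  assumes "tame F" "u \<noteq> v"
  shows "reflect u (integ N v F) = integ N v (reflect u F)"
proof -
  have "integ N v (reflect u F)
      = (\<lambda>f. integ N v F f - w (f u) * integ N v (integ N u (\<lambda>f. w (f u) * F f)) f)"
    unfolding reflect_def using assms
    by (simp add: integ_diff integ_mult_indep tame_mult tame_w tame_integ indep_w)
  also have "integ N v (integ N u (\<lambda>f. w (f u) * F f)) = integ N u (\<lambda>f. w (f u) * integ N v F f)"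
    using assms by (simp add: integ_commute[of _ N v u] tame_mult tame_w integ_mult_indep indep_w)
  finally show ?thesis by (simp add: reflect_def[of u "integ N v F"])
qed

lemma reflect_commute:
  assumes "tame F"
  shows "reflect u (reflect v F) = reflect v (reflect u F)"
proof (cases "u = v")
  case False
  have "reflect u (reflect v F)
      = (\<lambda>f. reflect u F f - w (f v) * reflect u (integ N v (\<lambda>f. w (f v) * F f)) f)"
    unfolding reflect_def[of v] using False assms
    by (simp add: reflect_diff reflect_mult_indep tame_mult tame_w tame_integ indep_w)
  also have "reflect u (integ N v (\<lambda>f. w (f v) * F f)) = integ N v (\<lambda>f. w (f v) * reflect u F f)"
    using False assms by (simp add: reflect_integ reflect_mult_indep tame_mult tame_w indep_w)
  finally show ?thesis by (simp add: reflect_def[of v "reflect u F"])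
qed simp

section \<open>Reflecting several points at once\<close>

definition reflects :: "'a list \<Rightarrow> (('a \<Rightarrow> nat) \<Rightarrow> complex) \<Rightarrow> ('a \<Rightarrow> nat) \<Rightarrow> complex" where
  "reflects vs F = foldr reflect vs F"

lemma reflects_simps [simp]:
  "reflects [] F = F" "reflects (v # vs) F = reflect v (reflects vs F)"
  by (simp_all add: reflects_def)

lemma reflects_append: "reflects (us @ vs) F = reflects us (reflects vs F)"
  by (simp add: reflects_def)

lemma tame_reflects: "tame F \<Longrightarrow> tame (reflects vs F)"
  by (induction vs) (auto intro: tame_reflect)

lemma indep_reflects: "indep u F \<Longrightarrow> u \<notin> set vs \<Longrightarrow> indep u (reflects vs F)"
  by (induction vs) (auto intro: indep_reflect)

lemma reflects_add:
  assumes "tame F" "tame G"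
  shows "reflects vs (\<lambda>f. F f + G f) = (\<lambda>f. reflects vs F f + reflects vs G f)"
  by (induction vs) (simp_all add: reflect_add tame_reflects assms)

lemma reflects_mult_indep:
  assumes "tame F" "\<And>v. v \<in> set vs \<Longrightarrow> indep v A"
  shows "reflects vs (\<lambda>f. A f * F f) = (\<lambda>f. A f * reflects vs F f)"
  using assms(2) by (induction vs) (simp_all add: reflect_mult_indep tame_reflects assms(1))

lemma reflects_cnj:
  assumes "tame F"
  shows "reflects vs (\<lambda>f. cnj (F f)) = (\<lambda>f. cnj (reflects vs F f))"
  by (induction vs) (simp_all add: reflect_cnj tame_reflects assms)

lemma reflects_comp:
  assumes "inj \<phi>"
  shows "reflects (map \<phi> vs) (\<lambda>f. F (f \<circ> \<phi>)) = (\<lambda>f. reflects vs F (f \<circ> \<phi>))"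
  by (induction vs) (simp_all only: list.map reflects_simps reflect_comp[OF assms])

lemma reflect_reflects:
  assumes "tame F"
  shows "reflect u (reflects vs F) = reflects vs (reflect u F)"
proof (induction vs)
  case (Cons v vs)
  then show ?case
    using reflect_commute[OF tame_reflects[OF assms, of vs], of u v] by simp
qed simp

lemma reflects_commute:
  assumes "tame F"
  shows "reflects us (reflects vs F) = reflects vs (reflects us F)"
proof (induction us)
  case (Cons u us)
  then show ?case by (simp add: reflect_reflects tame_reflects assms)
qed simp

lemma reflects_involution:
  assumes "tame F"
  shows "reflects vs (reflects vs F) = F"
proof (induction vs)
  case (Cons v vs)
  then show ?case
    using assms by (simp add: reflect_reflects[symmetric] tame_reflects reflect_involution)
qed simp

lemma reflects_integ:
  assumes "tame F" "v \<notin> set us"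
  shows "reflects us (integ N v F) = integ N v (reflects us F)"
  using assms(2) by (induction us) (simp_all add: reflect_integ[OF _ not_sym] tame_reflects assms(1))

lemma reflects_integs:
  assumes "tame F" "set us \<inter> set vs = {}"
  shows "reflects us (integs N vs F) = integs N vs (reflects us F)"
  using assms(2) by (induction vs) (simp_all add: reflects_integ tame_integs assms(1))

text \<open>The reflections move from \<open>F\<close> to \<open>G\<close> one variable at a time.
  \<open>G\<close> is generalized in the induction because it has already absorbed
  \<open>reflect v\<close> when the hypothesis is applied.\<close>

lemma integs_reflects_symmetric:
  assumes "tame F" "tame G"
  shows "integs N vs (\<lambda>f. reflects vs F f * G f) = integs N vs (\<lambda>f. F f * reflects vs G f)"
  using assms(2)
proof (induction vs arbitrary: G)
  case (Cons v vs)
  note tame = assms(1) Cons.prems tame_reflects tame_reflect tame_mult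
  have "integs N (v # vs) (\<lambda>f. reflects (v # vs) F f * G f)
      = integs N vs (integ N v (\<lambda>f. reflect v (reflects vs F) f * G f))"
    by (simp add: integ_integs tame)
  also have "\<dots> = integs N vs (integ N v (\<lambda>f. reflects vs F f * reflect v G f))"
    by (simp add: integ_reflect_symmetric tame)
  also have "\<dots> = integ N v (integs N vs (\<lambda>f. reflects vs F f * reflect v G f))"
    by (simp add: integ_integs tame)
  also have "\<dots> = integ N v (integs N vs (\<lambda>f. F f * reflects vs (reflect v G) f))"
    by (simp add: Cons.IH tame)
  finally show ?case by (simp add: reflect_reflects tame)
qed simp

lemma reflects_prod:
  assumes "distinct vs" "\<And>v. v \<in> set vs \<Longrightarrow> tame (\<phi> v)"
    and "\<And>u v. u \<in> set vs \<Longrightarrow> v \<in> set vs \<Longrightarrow> u \<noteq> v \<Longrightarrow> indep u (\<phi> v)"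
  shows "reflects vs (\<lambda>f. \<Prod>v\<leftarrow>vs. \<phi> v f) = (\<lambda>f. \<Prod>v\<leftarrow>vs. reflect v (\<phi> v) f)"
  using foldr_leg_prod[of reflect vs \<phi> "\<lambda>f. 1"] assms
  by (simp add: reflects_def reflect_mult_indep tame_reflect indep_reflect tame_const indep_const)

end


section \<open>Evaluating linear combinations of partitions on labelings\<close>

text \<open>The type of points is left open because both two-row partitions and the three-row
  diagram of a composition are tested.\<close>

definition agree :: "'a set set \<Rightarrow> ('a \<Rightarrow> nat) \<Rightarrow> complex" where
  "agree p f = of_bool (\<forall>B\<in>p. \<forall>x\<in>B. \<forall>y\<in>B. f x = f y)"

lemma tame_agree: "finite p \<Longrightarrow> (\<And>B. B \<in> p \<Longrightarrow> finite B) \<Longrightarrow> tame (agree p)"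
  unfolding agree_def by (intro tame_ball tame_eq)

lemma agree_image: "agree ((`) h ` p) f = agree p (f \<circ> h)"
  by (simp add: agree_def)

lemma agree_Un: "agree (p \<union> q) f = agree p f * agree q f"
  by (simp add: agree_def ball_Un flip: of_bool_conj)

text \<open>Equality of labels is transitive, so constancy on the stacked blocks propagates along
  chains of links to whole components; conversely each stacked block lies in one component.\<close>

lemma agree_components: "agree (components p q) f = agree (stack p q) f"
proof -
  have "f x = f y" if "\<forall>B\<in>stack p q. \<forall>x\<in>B. \<forall>y\<in>B. f x = f y" "(x, y) \<in> (linked p q)\<^sup>+" for x y
    using that(2)
  proof (induction rule: trancl_induct)
    case (base y)
    then show ?case using that(1) by (auto simp: linked_def)
  next
    case (step y z)
    then have "f y = f z" using that(1) by (auto simp: linked_def)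
    then show ?case using step.IH by simp
  qed
  moreover have "(x, y) \<in> (linked p q)\<^sup>+" if "C \<in> components p q" "x \<in> C" "y \<in> C" for C x y
    using that quotient_eq_iff[OF equiv_linked] unfolding components_def by metis
  moreover have "\<exists>C\<in>components p q. x \<in> C \<and> y \<in> C" if "B \<in> stack p q" "x \<in> B" "y \<in> B" for B x y
  proof -
    have "(x, x) \<in> (linked p q)\<^sup>+" "(x, y) \<in> (linked p q)\<^sup>+" "x \<in> \<Union>(stack p q)"
      using that by (auto simp: linked_def intro!: r_into_trancl)
    then show ?thesis unfolding components_def quotient_def by blast
  qed
  ultimately have "(\<forall>C\<in>components p q. \<forall>x\<in>C. \<forall>y\<in>C. f x = f y)
      \<longleftrightarrow> (\<forall>B\<in>stack p q. \<forall>x\<in>B. \<forall>y\<in>B. f x = f y)"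
    by meson
  then show ?thesis by (simp add: agree_def)
qed

text \<open>The variables are summed out one at a time. If \<open>v\<close> is the last remaining
  point of its block, its label is free and the sum gives a factor \<open>N\<close>; otherwise
  another remaining point \<open>u\<close> of the block forces the label, and the sum just deletes
  \<open>v\<close>. Exhausted blocks stay in the image as \<open>{}\<close>, on which
  \<open>agree\<close> imposes no condition.\<close>

lemma integs_agree:
  assumes "partition_on A P" "finite A" "distinct vs" "set vs \<subseteq> A"
  shows "integs N vs (agree P)
    = (\<lambda>f. N ^ card {C \<in> P. C \<subseteq> set vs} * agree ((\<lambda>C. C - set vs) ` P) f)"
  using assms(3,4)
proof (induction vs)
  case Nil
  have *: "{C \<in> P. C \<subseteq> set []} = {}" using assms(1) by (auto simp: partition_on_def)
  show ?case unfolding * by simp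
next
  case (Cons v vs)
  define S where "S = set vs"
  let ?Q = "(\<lambda>C. C - S) ` P" and ?Q' = "(\<lambda>C. C - insert v S) ` P"
  have "finite P" using assms by (simp add: finite_elements)
  have "finite C" if "C \<in> P" for C
    using that assms by (metis partition_on_def Union_upper finite_subset)
  then have tame: "tame (agree ?Q)"
    using \<open>finite P\<close> by (intro tame_agree) auto
  have v: "v \<in> A" "v \<notin> S" using Cons.prems by (auto simp: S_def)
  then obtain B where B: "B \<in> P" "v \<in> B" using assms(1) by (auto simp: partition_on_def)
  have B_unique: "C = B" if "C \<in> P" "v \<in> C" for C
    using that B assms(1) by (auto simp: partition_on_def pairwise_def disjnt_iff)
  have indep: "indep v (agree ?Q')" by (simp add: indep_def agree_def)
  have "integs N (v # vs) (agree P) = integ N v (\<lambda>f. N ^ card {C \<in> P. C \<subseteq> S} * agree ?Q f)"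
    using Cons by (simp add: S_def)
  also have "\<dots> = (\<lambda>f. N ^ card {C \<in> P. C \<subseteq> S} * integ N v (agree ?Q) f)"
    by (rule integ_mult_indep[OF tame indep_const])
  also have "\<dots> = (\<lambda>f. N ^ card {C \<in> P. C \<subseteq> insert v S} * agree ?Q' f)"
  proof (cases "B \<subseteq> insert v S")
    case True
    have "C - S = C - insert v S" if "C \<in> P" "C \<noteq> B" for C
      using that B_unique by blast
    moreover have "B - S = {v}" "B - insert v S = {}" using True B v by auto
    ultimately have "(\<forall>C\<in>P. \<forall>x\<in>C - S. \<forall>y\<in>C - S. f x = f y)
        \<longleftrightarrow> (\<forall>C\<in>P. \<forall>x\<in>C - insert v S. \<forall>y\<in>C - insert v S. f x = f y)" for f :: "'a \<Rightarrow> nat"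
      by (metis empty_iff singletonD)
    then have "agree ?Q = agree ?Q'"
      unfolding agree_def ball_simps by simp
    moreover have "{C \<in> P. C \<subseteq> insert v S} = insert B {C \<in> P. C \<subseteq> S}"
      using True B B_unique by blast
    moreover have "B \<notin> {C \<in> P. C \<subseteq> S}" using B v by blast
    ultimately show ?thesis
      using \<open>finite P\<close> by (simp add: integ_indep[OF indep] mult_ac)
  next
    case False
    then obtain u where u: "u \<in> B" "u \<notin> S" "u \<noteq> v" by blast
    have eq: "(\<forall>C\<in>P. \<forall>x\<in>C - S. \<forall>y\<in>C - S. f x = f y)
        \<longleftrightarrow> (\<forall>C\<in>P. \<forall>x\<in>C - insert v S. \<forall>y\<in>C - insert v S. f x = f y) \<and> f v = f u"
      (is "?l f \<longleftrightarrow> ?r f") for f :: "'a \<Rightarrow> nat"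
    proof
      show "?l f \<Longrightarrow> ?r f" using B u v by blast
    next
      assume r: "?r f"
      then have r': "f x = f y" if "C \<in> P" "x \<in> C - insert v S" "y \<in> C - insert v S" for C x y
        using that by blast
      have B_const: "f x = f u" if "x \<in> B - S" for x
      proof (cases "x = v")
        case True
        then show ?thesis using r by simp
      next
        case False
        then show ?thesis using that u by (intro r'[OF B(1)]) auto
      qed
      show "?l f"
      proof (intro ballI)
        fix C x y assume C: "C \<in> P" "x \<in> C - S" "y \<in> C - S"
        show "f x = f y"
        proof (cases "C = B")
          case True
          then show ?thesis using C B_const[of x] B_const[of y] by simp
        next
          case False
          then show ?thesis using C B_unique[of C] by (intro r'[of C]) auto
        qed
      qed
    qed
    have "agree ?Q = (\<lambda>f. agree ?Q' f * of_bool (f v = label f (Some u)))"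
      by (rule ext) (simp only: agree_def ball_simps(9) eq of_bool_conj label.simps)
    moreover have "{C \<in> P. C \<subseteq> insert v S} = {C \<in> P. C \<subseteq> S}"
      using u B_unique by blast
    ultimately show ?thesis
      using u by (simp add: integ_eq[OF indep, of "Some u", simplified])
  qed
  finally show ?case by (simp add: S_def)
qed

section \<open>Evaluation of linear combinations and of the category operations\<close>

definition ev :: "lin_partition \<Rightarrow> (point \<Rightarrow> nat) \<Rightarrow> complex" where
  "ev x f = (\<Sum>p\<in>Poly_Mapping.keys x. Poly_Mapping.lookup x p * agree p f)"

lemma ev_superset:
  assumes "finite S" "Poly_Mapping.keys x \<subseteq> S"
  shows "ev x f = (\<Sum>p\<in>S. Poly_Mapping.lookup x p * agree p f)"
  unfolding ev_def using assms by (intro sum.mono_neutral_left) (auto simp: in_keys_iff)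

lemma ev_zero [simp]: "ev 0 f = 0"
  by (simp add: ev_def)

lemma ev_add: "ev (x + y) f = ev x f + ev y f"
proof -
  let ?S = "Poly_Mapping.keys x \<union> Poly_Mapping.keys y"
  have "ev z f = (\<Sum>p\<in>?S. Poly_Mapping.lookup z p * agree p f)" if "Poly_Mapping.keys z \<subseteq> ?S" for z
    using that by (intro ev_superset) auto
  then show ?thesis
    using keys_add[of x y] by (simp add: lookup_add distrib_right sum.distrib)
qed

lemma ev_scale: "ev (scale c x) f = c * ev x f"
proof -
  have "Poly_Mapping.keys (scale c x) \<subseteq> Poly_Mapping.keys x" by (auto simp: in_keys_iff)
  then have "ev (scale c x) f = (\<Sum>p\<in>Poly_Mapping.keys x. Poly_Mapping.lookup (scale c x) p * agree p f)"
    by (intro ev_superset) auto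
  then show ?thesis by (simp add: ev_def sum_distrib_left mult.assoc)
qed

lemma ev_diff: "ev (x - y) f = ev x f - ev y f"
  using ev_add[of "x - y" y f] by simp

lemma ev_sum: "ev (\<Sum>i\<in>S. x i) f = (\<Sum>i\<in>S. ev (x i) f)"
  by (induction S rule: infinite_finite_induct) (simp_all add: ev_add)

lemma ev_basis: "ev (basis p) f = agree p f"
  by (simp add: ev_def basis_def)

lemma finite_points: "finite (points k l)"
  by (simp add: points_def)

lemma tame_agree_Partitions:
  assumes "p \<in> Partitions k l"
  shows "tame (agree p)"
proof (rule tame_agree)
  have p: "partition_on (points k l) p" using assms by (simp add: Partitions_def)
  show "finite p" using finite_elements[OF finite_points p] .
  show "finite B" if "B \<in> p" for B
    using p that by (metis partition_on_def Union_upper finite_subset finite_points)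
qed

lemma tame_ev:
  assumes "x \<in> Part k l"
  shows "tame (ev x)"
proof -
  have "tame (agree p)" if "p \<in> Poly_Mapping.keys x" for p
    using that assms tame_agree_Partitions by (auto simp: Part_def)
  then show ?thesis
    unfolding ev_def[abs_def] by (intro tame_sum tame_mult tame_const)
qed

lemma ev_cong:
  assumes "x \<in> Part k l" "\<And>v. v \<in> points k l \<Longrightarrow> f v = g v"
  shows "ev x f = ev x g"
proof -
  have "agree p f = agree p g" if "p \<in> Poly_Mapping.keys x" for p
  proof -
    have "B \<subseteq> points k l" if "B \<in> p" for B
      using that \<open>p \<in> Poly_Mapping.keys x\<close> assms(1) by (auto simp: Part_def Partitions_def partition_on_def)
    then have "(\<forall>x\<in>B. \<forall>y\<in>B. f x = f y) \<longleftrightarrow> (\<forall>x\<in>B. \<forall>y\<in>B. g x = g y)" if "B \<in> p" for B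
      using that assms(2) by (metis subsetD)
    then show ?thesis by (simp add: agree_def)
  qed
  then show ?thesis by (simp add: ev_def)
qed

lemma ev_tensor: "ev (tensor k l x y) f = ev x f * ev y (f \<circ> shift_point k l)"
proof -
  have "agree (tensor_partition k l p q) f = agree p f * agree q (f \<circ> shift_point k l)" for p q
    by (simp only: tensor_partition_def agree_Un agree_image)
  then show ?thesis
    by (simp add: tensor_def ev_sum ev_scale ev_basis ev_def[of x] ev_def[of y] sum_product mult_ac)
qed

lemma ev_star: "ev (star x) f = cnj (ev x (f \<circ> flip_point))"
proof -
  have "agree (flip_partition p) f = cnj (agree p (f \<circ> flip_point))" for p
    by (simp only: flip_partition_def agree_image) (simp add: agree_def)
  then show ?thesis
    by (simp add: star_def ev_sum ev_scale ev_basis ev_def[of x])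
qed

definition mids :: "nat \<Rightarrow> vertex list" where
  "mids l = map Mid [1..<Suc l]"

lemma set_mids: "set (mids l) = Mid ` {1..l}"
  by (auto simp: mids_def)

lemma distinct_mids: "distinct (mids l)"
  by (simp add: mids_def distinct_map inj_on_def)

text \<open>The product of the two tests is the test for the connected components of the stacked
  diagram. Summing out the middle row turns each component inside it into a factor
  \<open>\<delta>\<close> and restricts the others to the outer vertices.\<close>

lemma ev_composite_basis:
  assumes p: "p \<in> Partitions k l" and q: "q \<in> Partitions l m"
  shows "\<delta> ^ loops p q * agree (comp_partition q p) (g \<circ> outer)
    = integs \<delta> (mids l) (\<lambda>g. agree p (g \<circ> upper_half) * agree q (g \<circ> lower_half)) g"
proof -
  let ?A = "Top ` {1..k} \<union> Mid ` {1..l} \<union> Bot ` {1..m}" and ?P = "components p q"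
  note part = components_partition[OF p q]
  have join: "(\<lambda>g. agree p (g \<circ> upper_half) * agree q (g \<circ> lower_half)) = agree ?P"
    by (rule ext) (simp only: agree_components stack_def agree_Un agree_image)
  have integs: "integs \<delta> (mids l) (agree ?P) g
      = \<delta> ^ card {C \<in> ?P. C \<subseteq> set (mids l)} * agree ((\<lambda>C. C - set (mids l)) ` ?P) g"
    by (subst integs_agree[OF part]) (auto simp: set_mids distinct_mids)
  have sub: "C \<subseteq> ?A" if "C \<in> ?P" for C
    using that part by (auto simp: partition_on_def)
  have "C \<subseteq> set (mids l) \<longleftrightarrow> C \<subseteq> range Mid" if "C \<in> ?P" for C
    using sub[OF that] by (auto simp: set_mids)
  then have loops: "loops p q = card {C \<in> ?P. C \<subseteq> set (mids l)}"
    unfolding loops_def by (metis (mono_tags, lifting))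
  have restrict: "agree (comp_partition q p) (g \<circ> outer) = agree ((\<lambda>C. C - set (mids l)) ` ?P) g"
  proof -
    have outer: "C - set (mids l) = outer ` (outer -` C)" if "C \<in> ?P" for C
    proof -
      have "C - set (mids l) = C \<inter> range outer"
      proof (intro set_eqI iffI)
        fix x assume "x \<in> C - set (mids l)"
        then have "x \<in> C" "x \<in> Top ` {1..k} \<union> Bot ` {1..m}" using sub[OF that] by (auto simp: set_mids)
        then show "x \<in> C \<inter> range outer" by (metis IntI UnE imageE outer.simps rangeI)
      next
        fix x assume "x \<in> C \<inter> range outer"
        then obtain z where "x = outer z" "x \<in> C" by auto
        then show "x \<in> C - set (mids l)" by (cases z) (auto simp: set_mids)
      qed
      then show ?thesis by (simp add: Int_commute)
    qed
    have "(\<lambda>C. C - set (mids l)) ` ?P = (`) outer ` (-`) outer ` ?P"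
      unfolding image_image by (rule image_cong[OF refl outer])
    then have "agree ((\<lambda>C. C - set (mids l)) ` ?P) g = agree ((-`) outer ` ?P) (g \<circ> outer)"
      by (simp only: agree_image)
    \<comment> \<open>\<open>comp_partition\<close> discards the empty set left by the loops;
      \<open>agree\<close> does not notice.\<close>
    also have "\<dots> = agree (comp_partition q p) (g \<circ> outer)"
      unfolding agree_def comp_partition_def by (rule arg_cong[of _ _ of_bool]) blast
    finally show ?thesis ..
  qed
  show ?thesis unfolding join integs loops restrict ..
qed

lemma ev_composite:
  assumes x: "x \<in> Part k l" and y: "y \<in> Part l m"
  shows "ev (composite \<delta> y x) (g \<circ> outer)
    = integs \<delta> (mids l) (\<lambda>g. ev x (g \<circ> upper_half) * ev y (g \<circ> lower_half)) g"
proof -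
  let ?X = "Poly_Mapping.keys x" and ?Y = "Poly_Mapping.keys y"
  let ?c = "\<lambda>p q. Poly_Mapping.lookup x p * Poly_Mapping.lookup y q"
  let ?F = "\<lambda>p q g. agree p (g \<circ> upper_half) * agree q (g \<circ> lower_half)"
  have X: "p \<in> Partitions k l" if "p \<in> ?X" for p using that x by (auto simp: Part_def)
  have Y: "q \<in> Partitions l m" if "q \<in> ?Y" for q using that y by (auto simp: Part_def)
  have tame: "tame (?F p q)" if "p \<in> ?X" "q \<in> ?Y" for p q
    using that by (intro tame_mult tame_comp[of "agree _"] tame_agree_Partitions) (auto intro: X Y)
  have "ev (composite \<delta> y x) (g \<circ> outer)
      = (\<Sum>p\<in>?X. \<Sum>q\<in>?Y. ?c p q * (\<delta> ^ loops p q * agree (comp_partition q p) (g \<circ> outer)))"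
    by (simp add: composite_def ev_sum ev_scale ev_basis mult.assoc)
  also have "\<dots> = (\<Sum>p\<in>?X. \<Sum>q\<in>?Y. ?c p q * integs \<delta> (mids l) (?F p q) g)"
    by (intro sum.cong refl arg_cong2[of _ _ _ _ "(*)"] ev_composite_basis) (auto intro: X Y)
  also have "\<dots> = (\<Sum>p\<in>?X. \<Sum>q\<in>?Y. integs \<delta> (mids l) (\<lambda>g. ?c p q * ?F p q g) g)"
    by (intro sum.cong refl) (simp only: integs_cmult[OF tame])
  also have "\<dots> = integs \<delta> (mids l) (\<lambda>g. \<Sum>p\<in>?X. \<Sum>q\<in>?Y. ?c p q * ?F p q g) g"
    using tame by (simp add: integs_sum tame_sum tame_mult tame_const cong: sum.cong)
  also have "(\<lambda>g. \<Sum>p\<in>?X. \<Sum>q\<in>?Y. ?c p q * ?F p q g)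
      = (\<lambda>g. ev x (g \<circ> upper_half) * ev y (g \<circ> lower_half))"
    by (simp add: ev_def sum_product mult_ac)
  finally show ?thesis .
qed


section \<open>The category of reflection-invariant elements\<close>

definition all_points :: "nat \<Rightarrow> nat \<Rightarrow> point list" where
  "all_points k l = map Upper [1..<Suc k] @ map Lower [1..<Suc l]"

context reflection
begin

text \<open>Upper and lower points are reflected alike, with no dual action on one row, because the
  reflection is real, symmetric and its own inverse.\<close>

definition invariants :: "nat \<Rightarrow> nat \<Rightarrow> lin_partition set" where
  "invariants k l = {x \<in> Part k l. reflects (all_points k l) (ev x) = ev x}"

lemma reflects_cmult: "tame F \<Longrightarrow> reflects vs (\<lambda>f. c * F f) = (\<lambda>f. c * reflects vs F f)"
  by (simp add: reflects_mult_indep indep_const)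

lemma subspace_invariants: "part.subspace (invariants k l)"
proof (rule part.subspaceI)
  have "ev 0 = (\<lambda>f. 0)" by (simp add: fun_eq_iff)
  then show "0 \<in> invariants k l"
    using part.subspace_0[OF subspace_Part] reflects_cmult[OF tame_const, of "all_points k l" 0 0]
    by (simp add: invariants_def)
next
  fix x y assume x: "x \<in> invariants k l" and y: "y \<in> invariants k l"
  have "ev (x + y) = (\<lambda>f. ev x f + ev y f)" by (simp add: ev_add fun_eq_iff)
  then show "x + y \<in> invariants k l"
    using x y part.subspace_add[OF subspace_Part, of x k l y] tame_ev[of x k l] tame_ev[of y k l]
    by (simp add: invariants_def reflects_add)
next
  fix c x assume x: "x \<in> invariants k l"
  have "ev (scale c x) = (\<lambda>f. c * ev x f)" by (simp add: ev_scale fun_eq_iff)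
  then show "scale c x \<in> invariants k l"
    using x part.subspace_scale[OF subspace_Part, of x k l c] tame_ev[of x k l]
    by (simp add: invariants_def reflects_cmult)
qed

text \<open>The equality test is the kernel of the identity map. Reflecting at \<open>v\<close>
  makes it the kernel of the reflection, and reflecting at \<open>u\<close> as well composes the
  reflection with itself. This covers both \<open>id_part\<close> and
  \<open>pair_part\<close>.\<close>

lemma reflects_eq_pair:
  assumes "u \<noteq> v"
  shows "reflects [u, v] (\<lambda>f. of_bool (f u = f v)) = (\<lambda>f. of_bool (f u = f v))"
proof -
  have ne: "u \<noteq> v" "v \<noteq> u" using assms by auto
  have delta: "integ N v (\<lambda>f. w (f v) * of_bool (f u = f v)) = (\<lambda>f. w (f u))"
    using ne integ_subst[of u v N "\<lambda>f. w (f v)"] by simp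
  have delta': "integ N u (\<lambda>f. w (f u) * of_bool (f u = f v)) = (\<lambda>f. w (f v))"
    using ne integ_subst[of v u N "\<lambda>f. w (f u)"] by (simp add: eq_commute)
  have "reflects [u, v] (\<lambda>f. of_bool (f u = f v))
      = reflect u (\<lambda>f. of_bool (f u = f v) - w (f v) * w (f u))"
    by (simp add: reflect_def[of v] delta)
  also have "\<dots> = (\<lambda>f. reflect u (\<lambda>f. of_bool (f u = f v)) f - w (f v) * reflect u (\<lambda>f. w (f u)) f)"
    using ne by (simp add: reflect_diff reflect_mult_indep tame_eq tame_mult tame_w indep_w)
  also have "reflect u (\<lambda>f. w (f u)) = (\<lambda>f. - w (f u))"
    by (simp add: reflect_def integ_def lsum_ww)
  finally show ?thesis
    by (simp add: reflect_def delta' fun_eq_iff)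
qed

lemma tensor_invariants:
  assumes x: "x \<in> invariants k l" and y: "y \<in> invariants k' l'"
  shows "tensor k l x y \<in> invariants (k + k') (l + l')"
proof -
  let ?\<phi> = "shift_point k l"
  let ?U = "map Upper [1..<Suc k]" and ?L = "map Lower [1..<Suc l]"
  let ?U' = "map ?\<phi> (map Upper [1..<Suc k'])" and ?L' = "map ?\<phi> (map Lower [1..<Suc l'])"
  let ?Y = "\<lambda>f. ev y (f \<circ> ?\<phi>)"
  have "x \<in> Part k l" "y \<in> Part k' l'" using x y by (auto simp: invariants_def)
  then have Part: "tensor k l x y \<in> Part (k + k') (l + l')"
    using linear_category_Part unfolding linear_category_def by blast
  have tx: "tame (ev x)" and ty: "tame ?Y"
    using \<open>x \<in> Part k l\<close> \<open>y \<in> Part k' l'\<close> tame_ev tame_comp[of "ev y"] by blast+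
  have upt: "[1..<Suc (a + b)] = [1..<Suc a] @ map ((+) a) [1..<Suc b]" for a b
    by (induction b) simp_all
  \<comment> \<open>The rows of the two factors are interleaved here. The reflections are reordered
    by commutation so that those of each factor stand together, where they treat the other factor as
    a scalar.\<close>
  have points: "all_points (k + k') (l + l') = ?U @ ?U' @ ?L @ ?L'"
    unfolding all_points_def upt by simp
  have inj: "inj ?\<phi>"
    by (rule injI, rename_tac u v, case_tac u; case_tac v) auto
  have ind_y: "indep v ?Y" if v: "v \<in> set (?U @ ?L)" for v
    unfolding indep_def
  proof (intro allI ev_cong[OF \<open>y \<in> Part k' l'\<close>])
    fix f :: "point \<Rightarrow> nat" and i u assume "u \<in> points k' l'"
    then have "?\<phi> u \<noteq> v" using v by (cases u) (auto simp: points_def)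
    then show "(f(v := i) \<circ> ?\<phi>) u = (f \<circ> ?\<phi>) u" by simp
  qed
  have ind_x: "indep v (ev x)" if v: "v \<in> set (?U' @ ?L')" for v
    unfolding indep_def
  proof (intro allI ev_cong[OF \<open>x \<in> Part k l\<close>])
    fix f :: "point \<Rightarrow> nat" and i u assume "u \<in> points k l"
    then have "u \<noteq> v" using v by (auto simp: points_def)
    then show "(f(v := i)) u = f u" by simp
  qed
  have "reflects (all_points (k + k') (l + l')) (ev (tensor k l x y))
      = reflects ?U (reflects ?U' (reflects ?L (reflects ?L' (\<lambda>f. ev x f * ?Y f))))"
    by (simp only: points reflects_append ev_tensor[abs_def])
  also have "\<dots> = reflects (?U @ ?L) (reflects (?U' @ ?L') (\<lambda>f. ev x f * ?Y f))"
    using reflects_commute[of "reflects ?L' (\<lambda>f. ev x f * ?Y f)" ?U' ?L] tx ty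
    by (simp only: reflects_append tame_reflects tame_mult)
  also have "\<dots> = reflects (?U @ ?L) (\<lambda>f. ev x f * reflects (?U' @ ?L') ?Y f)"
    using ind_x by (subst reflects_mult_indep[OF ty]) blast+
  also have "reflects (?U' @ ?L') ?Y = ?Y"
    using reflects_comp[OF inj, of "all_points k' l'" "ev y"] y
    by (simp add: invariants_def all_points_def)
  also have "reflects (?U @ ?L) (\<lambda>f. ev x f * ?Y f) = (\<lambda>f. ?Y f * reflects (?U @ ?L) (ev x) f)"
    using ind_y reflects_mult_indep[OF tx, of "?U @ ?L" ?Y] by (simp add: mult.commute)
  also have "reflects (?U @ ?L) (ev x) = ev x"
    using x by (simp add: invariants_def all_points_def)
  finally show ?thesis
    using Part by (simp add: invariants_def ev_tensor[abs_def] mult.commute comp_def)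
qed

lemma star_invariants:
  assumes x: "x \<in> invariants k l"
  shows "star x \<in> invariants l k"
proof -
  have xP: "x \<in> Part k l" using x by (simp add: invariants_def)
  then have Part: "star x \<in> Part l k"
    using linear_category_Part unfolding linear_category_def by blast
  let ?X = "\<lambda>f. ev x (f \<circ> flip_point)"
  have inj: "inj flip_point" by (metis flip_flip injI)
  have tame: "tame ?X" using tame_ev[OF xP] tame_comp by blast
  let ?L = "map flip_point (map Lower [1..<Suc l])" and ?U = "map flip_point (map Upper [1..<Suc k])"
  \<comment> \<open>The flip exchanges the order in which the two rows are listed; commutation
    restores it.\<close>
  have "all_points l k = ?L @ ?U"
    by (simp add: all_points_def)
  then have "reflects (all_points l k) ?X = reflects (?U @ ?L) ?X"
    by (simp only: reflects_append reflects_commute[OF tame, of ?L ?U])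
  also have "\<dots> = reflects (map flip_point (all_points k l)) ?X"
    by (simp only: all_points_def map_append)
  also have "\<dots> = ?X"
    using reflects_comp[OF inj, of "all_points k l" "ev x"] x by (simp add: invariants_def)
  finally have "reflects (all_points l k) (ev (star x)) = ev (star x)"
    using reflects_cnj[OF tame, of "all_points l k"] by (simp add: ev_star[abs_def])
  then show ?thesis using Part by (simp add: invariants_def)
qed

text \<open>Invariance of \<open>x\<close> says that reflecting its top row has the same effect as
  reflecting its middle row (\<open>XT\<close>), and likewise for \<open>y\<close> with the bottom
  row (\<open>YB\<close>). Reflecting the outer points of the composite thus reflects both factors
  along the middle row, and under the sum over that row the two reflections cancel by symmetry and
  involutivity.\<close>

lemma composite_invariants:
  assumes x: "x \<in> invariants k l" and y: "y \<in> invariants l m"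
  shows "composite N y x \<in> invariants k m"
proof -
  have xP: "x \<in> Part k l" and yP: "y \<in> Part l m" using x y by (auto simp: invariants_def)
  then have Part: "composite N y x \<in> Part k m"
    using linear_category_Part unfolding linear_category_def by blast
  let ?Z = "ev (composite N y x)"
  let ?X = "\<lambda>g. ev x (g \<circ> upper_half)" and ?Y = "\<lambda>g. ev y (g \<circ> lower_half)"
  let ?T = "map Top [1..<Suc k]" and ?B = "map Bot [1..<Suc m]" and ?M = "mids l"
  have tX: "tame ?X" using tame_ev[OF xP] tame_comp by blast
  have tY: "tame ?Y" using tame_ev[OF yP] tame_comp by blast
  note tame = tX tY tame_reflects tame_mult
  have inj: "inj outer" "inj upper_half" "inj lower_half"
    by (rule injI, rename_tac u v, case_tac u; case_tac v; simp)+
  have X: "reflects ?T (reflects ?M ?X) = ?X"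
    using reflects_comp[OF inj(2), of "all_points k l" "ev x"] x
    by (simp add: invariants_def all_points_def mids_def reflects_append[symmetric] comp_def)
  have Y: "reflects ?M (reflects ?B ?Y) = ?Y"
    using reflects_comp[OF inj(3), of "all_points l m" "ev y"] y
    by (simp add: invariants_def all_points_def mids_def reflects_append[symmetric] comp_def)
  have XT: "reflects ?T ?X = reflects ?M ?X"
    using X reflects_involution[of "reflects ?M ?X" ?T] by (simp add: tame)
  have YB: "reflects ?B ?Y = reflects ?M ?Y"
    using Y reflects_involution[of "reflects ?B ?Y" ?M] by (simp add: tame)
  have ind_Y: "indep v ?Y" if "v \<in> set ?T" for v
    unfolding indep_def
  proof (intro allI ev_cong[OF yP])
    fix g :: "vertex \<Rightarrow> nat" and i u
    have "lower_half u \<noteq> v" using that by (cases u) auto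
    then show "(g(v := i) \<circ> lower_half) u = (g \<circ> lower_half) u" by simp
  qed
  have ind_X: "indep v ?X" if "v \<in> set ?B" for v
    unfolding indep_def
  proof (intro allI ev_cong[OF xP])
    fix g :: "vertex \<Rightarrow> nat" and i u
    have "upper_half u \<noteq> v" using that by (cases u) auto
    then show "(g(v := i) \<circ> upper_half) u = (g \<circ> upper_half) u" by simp
  qed
  have ind_YB: "indep v (reflects ?B ?Y)" if "v \<in> set ?T" for v
    using that by (intro indep_reflects ind_Y) auto
  have comp: "(\<lambda>g. ?Z (g \<circ> outer)) = integs N ?M (\<lambda>g. ?X g * ?Y g)"
    using ev_composite[OF xP yP] by blast
  have "(\<lambda>g. reflects (all_points k m) ?Z (g \<circ> outer))
      = reflects (map outer (all_points k m)) (\<lambda>g. ?Z (g \<circ> outer))"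
    by (rule reflects_comp[OF inj(1), symmetric])
  also have "\<dots> = reflects (?T @ ?B) (integs N ?M (\<lambda>g. ?X g * ?Y g))"
    by (simp only: comp) (simp add: all_points_def comp_def)
  also have "\<dots> = integs N ?M (reflects ?T (reflects ?B (\<lambda>g. ?X g * ?Y g)))"
    by (subst reflects_integs) (auto simp: tame set_mids reflects_append)
  also have "reflects ?B (\<lambda>g. ?X g * ?Y g) = (\<lambda>g. reflects ?B ?Y g * ?X g)"
    using reflects_mult_indep[OF tY ind_X] by (simp only: mult.commute)
  also have "reflects ?T \<dots> = (\<lambda>g. reflects ?T ?X g * reflects ?B ?Y g)"
    using reflects_mult_indep[OF tX ind_YB] by (simp only: mult.commute)
  also have "integs N ?M \<dots> = integs N ?M (\<lambda>g. reflects ?M ?X g * reflects ?M ?Y g)"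
    by (simp only: XT YB)
  also have "\<dots> = integs N ?M (\<lambda>g. ?X g * ?Y g)"
    by (simp only: integs_reflects_symmetric reflects_involution tame)
  also have "\<dots> = (\<lambda>g. ?Z (g \<circ> outer))"
    by (rule comp[symmetric])
  finally have eq: "reflects (all_points k m) ?Z (g \<circ> outer) = ?Z (g \<circ> outer)" for g
    by (rule fun_cong)
  \<comment> \<open>Every labeling of points extends to one of vertices, since \<open>outer\<close>
    is injective.\<close>
  have "reflects (all_points k m) ?Z f = ?Z f" for f
    using eq[of "f \<circ> inv outer"] by (simp add: comp_assoc inv_o_cancel[OF inj(1)])
  then show ?thesis using Part by (simp add: invariants_def fun_eq_iff)
qed

lemma linear_category_invariants: "linear_category N invariants"
proof -
  have "id_part \<in> Part 1 1" "pair_part \<in> Part 0 2"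
    using linear_category_Part by (auto simp: linear_category_def)
  moreover have "ev id_part = (\<lambda>f. of_bool (f (Upper 1) = f (Lower 1)))"
    "ev pair_part = (\<lambda>f. of_bool (f (Lower 1) = f (Lower 2)))"
    by (auto simp: id_part_def pair_part_def ev_basis agree_def fun_eq_iff)
  moreover have "all_points 1 1 = [Upper 1, Lower 1]" "all_points 0 2 = [Lower 1, Lower 2]"
    by (simp_all add: all_points_def numeral_2_eq_2)
  moreover have "reflects [u, v] (\<lambda>f. of_bool (f u = f v)) = (\<lambda>f. of_bool (f u = f v))"
    if "u \<noteq> v" for u v :: point
    using that by (rule reflects_eq_pair)
  ultimately have "id_part \<in> invariants 1 1" "pair_part \<in> invariants 0 2"
    unfolding invariants_def mem_Collect_eq by force+
  then show ?thesis
    unfolding linear_category_def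
    using subspace_invariants tensor_invariants composite_invariants star_invariants
    by (auto simp: invariants_def)
qed


section \<open>Images of one-block partitions\<close>

definition block :: "nat \<Rightarrow> partition" where
  "block l = {Lower ` {1..l}}"

text \<open>
  Points are numbered from 1, so \<open>Upper 0\<close> is free to serve as the summation variable. The last
  term belongs to the additional label in a sum over \<open>N + 1\<close> labels.
\<close>

definition twisted :: "nat \<Rightarrow> (point \<Rightarrow> nat) \<Rightarrow> complex" where
  "twisted l f = integ N (Upper 0) (\<lambda>f. \<Prod>v\<leftarrow>all_points 0 l. of_bool (f (Upper 0) = f v) - a) f + (- t) ^ l"

lemma tame_leg: "tame (\<lambda>f. of_bool (f u = f v) - a)"
  by (intro tame_diff tame_eq tame_const)

text \<open>
  The reflection acts like the transposition of the label \<open>0\<close> and the additional label: it swaps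
  the vector \<open>\<lambda>i. of_bool (i = 0) - a\<close> of the former with the constant \<open>- t\<close> of the latter, and
  fixes the vectors of all other labels.
\<close>

lemma reflect_leg:
  assumes "u \<noteq> v"
  shows "reflect v (\<lambda>f. of_bool (f u = f v) - a)
    = (\<lambda>f. if f u = 0 then - t else of_bool (f u = f v) - a)"
proof -
  have "lsum N (\<lambda>i. w i * (of_bool (j = i) - a)) = of_bool (j = 0)" for j
  proof -
    have "eventually_const (\<lambda>i. of_bool (j = i))"
      by (auto simp: eventually_const_def intro: exI[of _ "Suc j"])
    moreover have "eventually_const (\<lambda>i. - a)" by (simp add: eventually_const_def)
    ultimately have "lsum N (\<lambda>i. of_bool (j = i) + - a) = 1 + N * - a"
      using lsum_delta'[of N "\<lambda>i. 1" j] by (subst lsum_add) (simp_all add: lsum_const)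
    moreover have "eventually_const (\<lambda>i. of_bool (j = i) - a)"
      by (auto simp: eventually_const_def intro: exI[of _ "Suc j"])
    ultimately have "lsum N (\<lambda>i. w i * (of_bool (j = i) - a)) = of_bool (j = 0) - a + (t - a) * t"
      using aN by (simp add: lsum_w mult.commute)
    also have "\<dots> = of_bool (j = 0)" using at by algebra
    finally show ?thesis .
  qed
  then show ?thesis
    using assms by (auto simp: reflect_def integ_def fun_eq_iff w_def)
qed

lemma reflect_one: "reflect v (\<lambda>f. 1) = (\<lambda>f. 1 - w (f v) / t)"
  by (simp add: reflect_def integ_def lsum_w1)

text \<open>Applied to all legs, the reflection exchanges the summand of label 0, which is
  \<open>?H\<close>, with the additional term \<open>(- t) ^ l\<close> and fixes the other summands.
  In the formal sum, replacing the summand of label 0 is expressed by adding a correction supported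
  at \<open>f ?y = 0\<close>, which \<open>integ_eq\<close> evaluates.\<close>

lemma reflects_twisted: "reflects (all_points 0 l) (twisted l) = twisted l"
proof -
  let ?L = "all_points 0 l" and ?y = "Upper 0"
  let ?G = "\<lambda>f. \<Prod>v\<leftarrow>?L. of_bool (f ?y = f v) - a"
  let ?H = "\<lambda>f. \<Prod>v\<leftarrow>?L. of_bool (0 = f v) - a"
  have L: "distinct ?L" "?y \<notin> set ?L" "length ?L = l"
    by (auto simp: all_points_def distinct_map inj_on_def simp del: upt_Suc)
  have tame: "tame ?G" by (intro tame_prod_list tame_leg)
  have leg0: "tame (\<lambda>f. of_bool (0 = f v) - a)" for v :: point
    using tame_diff[OF tame_label[of None "Some v"] tame_const[of a]] by simp
  have tame0: "tame ?H" by (intro tame_prod_list leg0)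
  have "reflects ?L ?G = (\<lambda>f. \<Prod>v\<leftarrow>?L. reflect v (\<lambda>f. of_bool (f ?y = f v) - a) f)"
    using L by (intro reflects_prod tame_leg) (auto simp: indep_def)
  also have "\<dots> = (\<lambda>f. \<Prod>v\<leftarrow>?L. if f ?y = 0 then - t else of_bool (f ?y = f v) - a)"
  proof (intro ext prod_list_cong)
    fix f :: "point \<Rightarrow> nat" and v assume "v \<in> set ?L"
    then have "?y \<noteq> v" using L(2) by metis
    then show "reflect v (\<lambda>f. of_bool (f ?y = f v) - a) f = (if f ?y = 0 then - t else of_bool (f ?y = f v) - a)"
      by (intro fun_cong[OF reflect_leg])
  qed
  also have "\<dots> = (\<lambda>f. ?G f + of_bool (f ?y = 0) * ((- t) ^ l - ?H f))"
  proof (rule ext)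
    fix f
    show "(\<Prod>v\<leftarrow>?L. if f ?y = 0 then - t else of_bool (f ?y = f v) - a)
        = ?G f + of_bool (f ?y = 0) * ((- t) ^ l - ?H f)"
      using L(3) by (cases "f ?y = 0") (simp_all add: map_replicate_const)
  qed
  finally have G: "reflects ?L ?G = (\<lambda>f. ?G f + ((- t) ^ l - ?H f) * of_bool (f ?y = label f None))"
    by (simp add: mult.commute)
  have ind: "indep ?y (\<lambda>f. (- t) ^ l - ?H f)"
    using L(2) by (intro indep_diff indep_const indep_prod_list) (auto simp: indep_def)
  have "tame (\<lambda>f. of_bool (f ?y = label f None))"
    using tame_zero_label[of ?y] by simp
  then have "tame (\<lambda>f. ((- t) ^ l - ?H f) * of_bool (f ?y = label f None))"
    by (intro tame_mult tame_diff tame_const tame0)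
  then have "reflects ?L (integ N ?y ?G) = (\<lambda>f. integ N ?y ?G f + ((- t) ^ l - ?H f))"
    by (simp only: reflects_integ[OF tame L(2)] G integ_add[OF tame] integ_eq[OF ind option.distinct(1)])
  moreover have "reflects ?L (\<lambda>f. (- t) ^ l) = ?H"
  proof -
    have "reflects ?L (\<lambda>f. \<Prod>v\<leftarrow>?L. - t) = (\<lambda>f. \<Prod>v\<leftarrow>?L. reflect v (\<lambda>f. - t) f)"
      using L(1) by (intro reflects_prod tame_const indep_const)
    \<comment> \<open>The image is \<open>- t * (1 - w (f v) / t) = w (f v) - t\<close>, the vector
      of label 0.\<close>
    moreover have "reflect v (\<lambda>f. - t) = (\<lambda>f. of_bool (0 = f v) - a)" for v :: point
      using reflect_mult_indep[OF tame_const indep_const, of v "- t" 1] t_nonzero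
      by (auto simp: reflect_one fun_eq_iff w_def right_diff_distrib)
    ultimately show ?thesis
      using L(3) by (simp add: map_replicate_const)
  qed
  ultimately show ?thesis
    unfolding twisted_def[abs_def] using tame by (simp add: reflects_add tame_integ tame_const)
qed

lemma prod_list_of_bool: "(\<Prod>v\<leftarrow>vs. of_bool (P v)) = (of_bool (\<forall>v\<in>set vs. P v) :: complex)"
  by (induction vs) (auto simp flip: of_bool_conj)

text \<open>Exactly one label \<open>y\<close> fits when the points agree, and none otherwise. With
  the common label as a summation variable, the test of a block becomes a product over its
  points.\<close>

lemma integ_all_equal:
  assumes "vs \<noteq> []" "y \<notin> set vs"
  shows "integ N y (\<lambda>f. \<Prod>v\<leftarrow>vs. of_bool (f y = f v)) = agree {set vs}"
proof -
  let ?u = "hd vs"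
  have u: "?u \<in> set vs" using assms(1) by simp
  have "x \<noteq> y" if "x \<in> set vs" for x
    using that assms(2) by blast
  then have indep: "indep y (agree {set vs})"
    by (simp add: indep_def agree_def cong: ball_cong)
  have "(\<forall>v\<in>set vs. f y = f v) \<longleftrightarrow> (\<forall>x\<in>set vs. \<forall>z\<in>set vs. f x = f z) \<and> f y = f ?u"
    (is "?l \<longleftrightarrow> ?r") for f :: "'a \<Rightarrow> nat"
  proof
    assume l: ?l
    have "f x = f z" if "x \<in> set vs" "z \<in> set vs" for x z
      using bspec[OF l that(1)] bspec[OF l that(2)] by simp
    then show ?r using l u by blast
  next
    assume r: ?r
    show ?l
    proof
      fix v assume "v \<in> set vs"
      then have "f ?u = f v" using r u by blast
      then show "f y = f v" using r by simp
    qed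
  qed
  then have "(\<lambda>f. \<Prod>v\<leftarrow>vs. of_bool (f y = f v)) = (\<lambda>f. agree {set vs} f * of_bool (f y = label f (Some ?u)))"
    by (intro ext) (simp only: prod_list_of_bool agree_def of_bool_conj label.simps ball_simps
        of_bool_eq mult_1_right)
  moreover have "Some ?u \<noteq> Some y" using u assms(2) by auto
  ultimately show ?thesis
    using integ_eq[OF indep, of "Some ?u" N] by (simp only: not_False_eq_True)
qed

lemma prod_list_mult_map:
  fixes A B :: "'a \<Rightarrow> complex"
  shows "(\<Prod>v\<leftarrow>vs. A v * B v) = (\<Prod>v\<leftarrow>vs. A v) * (\<Prod>v\<leftarrow>vs. B v)"
  by (induction vs) simp_all

lemma B_map_basis: "B_map (basis p) = B_partition p"
  by (simp add: B_map_def basis_def)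

lemma ev_B_block:
  assumes "l > 0"
  shows "ev (B_map (basis (block l))) f = agree (block l) f + (- 1) ^ l"
proof -
  let ?b = "Lower ` {1..l}"
  have "card ?b = l" by (simp add: card_image inj_on_def)
  moreover have "Pow {?b} = {{}, {?b}}" by auto
  moreover have "agree ((\<lambda>x. {x}) ` S) f = 1" for S by (simp add: agree_def)
  ultimately show ?thesis
    by (simp add: B_map_basis B_partition_def block_def ev_add ev_scale ev_basis)
qed

lemma block_in: "l > 0 \<Longrightarrow> block l \<in> Partitions 0 l"
  by (auto simp: Partitions_def block_def points_def partition_on_def)

context
  fixes u :: lin_partition
  assumes u: "u = id_part - scale a (basis {{Upper 1}, {Lower 1}})"
begin

lemma u_in_Part: "u \<in> Part 1 1"
proof -
  have "{{Upper 1}, {Lower 1}} \<in> Partitions 1 1"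
    by (auto simp: Partitions_def points_def partition_on_def pairwise_def)
  moreover have "id_part \<in> Part 1 1"
    using linear_category_Part by (auto simp: linear_category_def)
  ultimately show ?thesis
    unfolding u using subspace_Part
    by (intro part.subspace_diff part.subspace_scale basis_in_Part)
qed

lemma tensor_power_in_Part: "tensor_power u l \<in> Part l l"
proof (induction l)
  case 0
  show ?case by (auto intro!: basis_in_Part simp: Partitions_def points_def partition_on_empty)
next
  case (Suc l)
  have "tensor l l (tensor_power u l) u \<in> Part (l + 1) (l + 1)"
    using linear_category_Part Suc u_in_Part unfolding linear_category_def by blast
  then show ?case by simp
qed

lemma ev_tensor_power:
  "ev (tensor_power u l) f = (\<Prod>i\<leftarrow>[1..<Suc l]. of_bool (f (Upper i) = f (Lower i)) - a)"
proof (induction l)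
  case 0
  show ?case by (simp add: ev_basis agree_def)
next
  case (Suc l)
  have "ev u f = of_bool (f (Upper 1) = f (Lower 1)) - a" for f
    by (auto simp: u id_part_def ev_diff ev_scale ev_basis agree_def)
  then show ?case using Suc by (simp add: ev_tensor)
qed

text \<open>Written over the common label \<open>y\<close>, the block is a sum of products of one
  vector per leg. On each leg \<open>u\<close> subtracts \<open>a\<close> from the vector of
  \<open>y\<close>, and multiplies the constant 1 by \<open>1 - a * N = t\<close>; so the singletons
  in the image under \<open>B_map\<close>, with sign \<open>(- 1) ^ l\<close>, contribute
  \<open>(- t) ^ l\<close>.\<close>

lemma ev_twist:
  assumes "l > 0"
  shows "ev (composite N (tensor_power u l) (composite N (B_map (basis (block l))) (tensor_power u 0)))
    = twisted l"
proof -
  let ?B = "B_map (basis (block l))" and ?E = "tensor_power u 0" and ?U = "tensor_power u l"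
  \<comment> \<open>\<open>Top 0\<close> is not a vertex of the diagram and is free for the common
    label; it is the image under \<open>outer\<close> of \<open>Upper 0\<close>, the summation
    variable of \<open>twisted\<close>.\<close>
  let ?C = "composite N ?B ?E" and ?M = "mids l" and ?y = "Top 0"
  have BP: "?B \<in> Part 0 l"
    using B_partition_in_Part[OF block_in[OF assms]] by (simp add: B_map_basis)
  have EP: "?E \<in> Part 0 0" and UP: "?U \<in> Part l l"
    by (rule tensor_power_in_Part)+
  have CP: "?C \<in> Part 0 l"
    using linear_category_Part BP EP unfolding linear_category_def by blast
  have factor: "\<exists>g. f = g \<circ> outer" for f :: "point \<Rightarrow> nat"
  proof -
    have "inj outer" by (rule injI, rename_tac u v, case_tac u; case_tac v) auto
    then have "f = (f \<circ> inv outer) \<circ> outer" by (simp add: comp_assoc)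
    then show ?thesis by blast
  qed
  \<comment> \<open>There are no upper points, so composing with the empty partition changes
    nothing.\<close>
  have C: "ev ?C f = ev ?B f" for f
  proof -
    obtain g where f: "f = g \<circ> outer" using factor by blast
    have "ev ?C f = ev ?B (g \<circ> lower_half)"
      using ev_composite[OF EP BP, of N g] by (simp add: f mids_def ev_basis agree_def)
    also have "\<dots> = ev ?B f"
      by (rule ev_cong[OF BP]) (auto simp: f points_def)
    finally show ?thesis .
  qed
  \<comment> \<open>\<open>bot\<close> sends a middle vertex to the bottom vertex at the other end
    of its copy of \<open>u\<close>.\<close>
  define bot where "bot v = (case v of Mid i \<Rightarrow> Bot i | _ \<Rightarrow> v)" for v
  let ?\<phi> = "\<lambda>v g. of_bool (g v = g (bot v)) - a"
  have bot: "bot v \<noteq> ?y" "bot v \<notin> set ?M" "v \<noteq> ?y" if "v \<in> set ?M" for v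
    using that by (auto simp: bot_def set_mids)
  have M: "?M \<noteq> []" "length ?M = l" using assms by (auto simp: mids_def)
  have UM: "ev ?U (g \<circ> lower_half) = (\<Prod>v\<leftarrow>?M. ?\<phi> v g)" for g
    by (simp add: ev_tensor_power mids_def bot_def comp_def del: upt_Suc)
  have "agree (block l) (g \<circ> upper_half) = agree {set ?M} g" for g
    by (simp add: agree_def block_def set_mids)
  then have "ev ?B (g \<circ> upper_half) = agree {set ?M} g + (- 1) ^ l" for g
    by (simp only: ev_B_block[OF assms])
  also have "agree {set ?M} = integ N ?y (\<lambda>g. \<Prod>v\<leftarrow>?M. of_bool (g ?y = g v))"
    by (rule integ_all_equal[symmetric]) (use M bot in auto)
  finally have BM: "ev ?B (g \<circ> upper_half) = integ N ?y (\<lambda>g. \<Prod>v\<leftarrow>?M. of_bool (g ?y = g v)) g + (- 1) ^ l"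
    for g .
  have tame1: "tame (\<lambda>g. \<Prod>v\<leftarrow>?M. of_bool (g ?y = g v))"
    and tame2: "tame (\<lambda>g. \<Prod>v\<leftarrow>?M. ?\<phi> v g)"
    and tame3: "tame (\<lambda>g. \<Prod>v\<leftarrow>?M. of_bool (g ?y = g v) * ?\<phi> v g)"
    by (intro tame_prod_list tame_mult tame_eq tame_leg)+
  have ind: "indep ?y (\<lambda>g. \<Prod>v\<leftarrow>?M. ?\<phi> v g)"
    using bot by (intro indep_prod_list) (auto simp: indep_def)
  have "(\<lambda>g. ev ?C (g \<circ> upper_half) * ev ?U (g \<circ> lower_half))
      = (\<lambda>g. (\<Prod>v\<leftarrow>?M. ?\<phi> v g) * integ N ?y (\<lambda>g. \<Prod>v\<leftarrow>?M. of_bool (g ?y = g v)) g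
          + (- 1) ^ l * (\<Prod>v\<leftarrow>?M. ?\<phi> v g))"
    unfolding C BM UM by (simp add: algebra_simps)
  also have "\<dots> = (\<lambda>g. integ N ?y (\<lambda>g. \<Prod>v\<leftarrow>?M. of_bool (g ?y = g v) * ?\<phi> v g) g
          + (- 1) ^ l * (\<Prod>v\<leftarrow>?M. ?\<phi> v g))"
  proof -
    have eq: "(\<lambda>g. \<Prod>v\<leftarrow>?M. of_bool (g ?y = g v) * ?\<phi> v g)
        = (\<lambda>g. (\<Prod>v\<leftarrow>?M. ?\<phi> v g) * (\<Prod>v\<leftarrow>?M. of_bool (g ?y = g v)))"
      by (simp only: prod_list_mult_map mult.commute)
    have "integ N ?y (\<lambda>g. \<Prod>v\<leftarrow>?M. of_bool (g ?y = g v) * ?\<phi> v g)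
        = (\<lambda>g. (\<Prod>v\<leftarrow>?M. ?\<phi> v g) * integ N ?y (\<lambda>g. \<Prod>v\<leftarrow>?M. of_bool (g ?y = g v)) g)"
      by (rule trans[OF arg_cong[of _ _ "integ N ?y", OF eq] integ_mult_indep[OF tame1 ind]])
    from this[symmetric] show ?thesis
      by (rule arg_cong[of _ _ "\<lambda>F g. F g + (- 1) ^ l * (\<Prod>v\<leftarrow>?M. ?\<phi> v g)"])
  qed
  finally have joint: "(\<lambda>g. ev ?C (g \<circ> upper_half) * ev ?U (g \<circ> lower_half))
      = (\<lambda>g. integ N ?y (\<lambda>g. \<Prod>v\<leftarrow>?M. of_bool (g ?y = g v) * ?\<phi> v g) g
          + (- 1) ^ l * (\<Prod>v\<leftarrow>?M. ?\<phi> v g))" .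
  \<comment> \<open>By Fubini the middle row is summed before the common label, so that each leg can
    be evaluated on its own.\<close>
  have total: "ev (composite N ?U ?C) (g \<circ> outer)
      = integ N ?y (integs N ?M (\<lambda>g. \<Prod>v\<leftarrow>?M. of_bool (g ?y = g v) * ?\<phi> v g)) g
        + (- 1) ^ l * integs N ?M (\<lambda>g. \<Prod>v\<leftarrow>?M. ?\<phi> v g) g" for g
    unfolding ev_composite[OF CP UP] joint using tame1 tame2 tame3
    by (simp add: integs_add integs_cmult tame_integ tame_mult tame_const
        integ_integs)
  have "integs N ?M (\<lambda>g. \<Prod>v\<leftarrow>?M. of_bool (g ?y = g v) * ?\<phi> v g)
      = (\<lambda>g. \<Prod>v\<leftarrow>?M. integ N v (\<lambda>g. of_bool (g ?y = g v) * ?\<phi> v g) g)"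
    using bot distinct_mids
    by (intro integs_prod tame_mult tame_eq tame_leg indep_mult) (auto simp: indep_def)
  also have "\<dots> = (\<lambda>g. \<Prod>v\<leftarrow>?M. of_bool (g ?y = g (bot v)) - a)"
  proof (intro ext prod_list_cong)
    fix g v assume v: "v \<in> set ?M"
    then have "bot v \<noteq> v" using bot by metis
    then show "integ N v (\<lambda>g. of_bool (g ?y = g v) * ?\<phi> v g) g = of_bool (g ?y = g (bot v)) - a"
      using integ_subst[of ?y v N "?\<phi> v"] bot(3)[OF v] by (simp add: mult.commute)
  qed
  finally have legs: "integs N ?M (\<lambda>g. \<Prod>v\<leftarrow>?M. of_bool (g ?y = g v) * ?\<phi> v g)
      = (\<lambda>g. \<Prod>v\<leftarrow>?M. of_bool (g ?y = g (bot v)) - a)" .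
  have "integs N ?M (\<lambda>g. \<Prod>v\<leftarrow>?M. ?\<phi> v g) = (\<lambda>g. \<Prod>v\<leftarrow>?M. integ N v (?\<phi> v) g)"
    using bot distinct_mids by (intro integs_prod tame_leg) (auto simp: indep_def)
  also have "\<dots> = (\<lambda>g. \<Prod>v\<leftarrow>?M. t)"
  proof (intro ext prod_list_cong)
    fix g v assume v: "v \<in> set ?M"
    then have "bot v \<noteq> v" using bot by metis
    then show "integ N v (?\<phi> v) g = t"
      using integ_eq[OF indep_const, of "Some (bot v)" v N 1] aN
      by (simp add: integ_diff tame_eq tame_const integ_indep indep_const mult.commute)
  qed
  finally have legs': "integs N ?M (\<lambda>g. \<Prod>v\<leftarrow>?M. ?\<phi> v g) = (\<lambda>g. \<Prod>v\<leftarrow>?M. t)" .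
  have "ev (composite N ?U ?C) (g \<circ> outer)
      = integ N ?y (\<lambda>g. \<Prod>v\<leftarrow>?M. of_bool (g ?y = g (bot v)) - a) g + (- t) ^ l" for g
    unfolding total legs legs' using M(2) by (simp add: map_replicate_const power_minus[of t])
  moreover have "integ N ?y (\<lambda>g. \<Prod>v\<leftarrow>?M. of_bool (g ?y = g (bot v)) - a) g + (- t) ^ l
      = twisted l (g \<circ> outer)" for g
  proof -
    have inj: "inj outer" by (rule injI, rename_tac u v, case_tac u; case_tac v) auto
    have bots: "map bot ?M = map outer (all_points 0 l)"
      by (simp add: mids_def all_points_def bot_def del: upt_Suc)
    have "(\<Prod>v\<leftarrow>?M. h (bot v)) = prod_list (map h (map bot ?M))" for h :: "vertex \<Rightarrow> complex"
      by (simp only: map_map comp_def)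
    then have "(\<Prod>v\<leftarrow>?M. h (bot v)) = (\<Prod>v\<leftarrow>all_points 0 l. h (outer v))" for h :: "vertex \<Rightarrow> complex"
      by (simp only: bots map_map comp_def)
    note legs = this[of "\<lambda>v. of_bool (g ?y = g v) - a" for g :: "vertex \<Rightarrow> nat"]
    have "integ N (outer (Upper 0)) (\<lambda>g. \<Prod>v\<leftarrow>?M. of_bool (g ?y = g (bot v)) - a) g
        = integ N (Upper 0) (\<lambda>f. \<Prod>v\<leftarrow>all_points 0 l. of_bool (f (Upper 0) = f v) - a) (g \<circ> outer)"
      using fun_cong[OF integ_comp[OF inj, of N "Upper 0"
          "\<lambda>f. \<Prod>v\<leftarrow>all_points 0 l. of_bool (f (Upper 0) = f v) - a"], of g]
      by (simp only: legs comp_apply outer.simps)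
    then show ?thesis
      by (simp only: twisted_def outer.simps)
  qed
  ultimately have "ev (composite N ?U ?C) (g \<circ> outer) = twisted l (g \<circ> outer)" for g
    by (simp only:)
  then show ?thesis using factor by (intro ext) metis
qed

end

lemma twisted_in_invariants: "x \<in> Part 0 l \<Longrightarrow> ev x = twisted l \<Longrightarrow> x \<in> invariants 0 l"
  by (simp add: invariants_def reflects_twisted)

section \<open>Detecting a non-invariant partition and refuting easiness\<close>

lemma all_points_eq:
  "l \<ge> 2 \<Longrightarrow> all_points 0 l = Lower 1 # Lower 2 # map Lower [3..<Suc l]"
  by (simp add: all_points_def upt_conv_Cons numeral_3_eq_3 numeral_2_eq_2 del: upt_Suc)

text \<open>
  The difference of the two values extracts the coefficient of the partition with the only
  non-singleton block \<open>{1', 2'}\<close>.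
\<close>

lemma twisted_diff:
  fixes f g :: "point \<Rightarrow> nat"
  assumes l: "l \<ge> 2" and f: "f (Lower 1) = 0" "f (Lower 2) = 0" "\<And>i. i \<ge> 3 \<Longrightarrow> f (Lower i) = i"
    and g: "\<And>i. g (Lower i) = i"
  shows "twisted l f - twisted l g = (- a) ^ (l - 2)"
proof -
  let ?y = "Upper 0"
  let ?G = "\<lambda>f. \<Prod>v\<leftarrow>all_points 0 l. of_bool (f ?y = f v) - a"
  define R where "R y = (\<Prod>i\<leftarrow>[3..<Suc l]. of_bool (y = i) - a)" for y
  \<comment> \<open>For \<open>y < 3\<close> none of the tests \<open>y = i\<close> succeeds, so all
    \<open>l - 2\<close> factors are \<open>- a\<close>.\<close>
  have R: "R y = (- a) ^ (l - 2)" if "y < 3" for y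
  proof -
    have "R y = (\<Prod>i\<leftarrow>[3..<Suc l]. - a)"
      unfolding R_def using that by (intro prod_list_cong) auto
    then show ?thesis by (simp add: map_replicate_const del: upt_Suc)
  qed
  have prod: "?G (h(?y := y)) = (of_bool (y = h (Lower 1)) - a) * (of_bool (y = h (Lower 2)) - a) * R y"
    if "\<And>i. i \<ge> 3 \<Longrightarrow> h (Lower i) = i" for h y
  proof -
    have "(\<Prod>i\<leftarrow>[3..<Suc l]. of_bool (y = h (Lower i)) - a) = R y"
      unfolding R_def using that by (intro prod_list_cong) auto
    then show ?thesis
      by (simp add: all_points_eq[OF l] comp_def del: upt_Suc)
  qed
  have delta: "eventually_const (\<lambda>i. h i * of_bool (i = k))" for h :: "nat \<Rightarrow> complex" and k
    by (auto simp: eventually_const_def intro: exI[of _ "Suc k"])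
  have ec_add: "eventually_const (\<lambda>i. h i + k i)" if hk: "eventually_const h" "eventually_const k" for h k
  proof -
    obtain n where n: "\<And>i. i \<ge> n \<Longrightarrow> h i = h n" "\<And>i. i \<ge> n \<Longrightarrow> k i = k n"
      using eventually_constE[OF hk] by blast
    show ?thesis
      unfolding eventually_const_def by (intro exI[of _ n] allI impI arg_cong2[of _ _ _ _ "(+)"] n)
  qed
  have tame: "tame ?G" by (intro tame_prod_list tame_leg)
  have ec_g: "eventually_const (\<lambda>y. ?G (g(?y := y)))" by (rule tame_eventually_const[OF tame])
  have prod_f: "?G (f(?y := y)) = (of_bool (y = 0) - a) * (of_bool (y = 0) - a) * R y" for y
    using prod[OF f(3)] by (simp only: f(1,2))
  have prod_g: "?G (g(?y := y)) = (of_bool (y = 1) - a) * (of_bool (y = 2) - a) * R y" for y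
    using prod[OF g] by (simp only: g)
  \<comment> \<open>The products differ only at the labels 0, 1 and 2. There \<open>R\<close> has
    the same value, and the coefficients \<open>1 - 2 * a\<close>, \<open>a\<close> and
    \<open>a\<close> add up to 1.\<close>
  have "?G (f(?y := y)) = ?G (g(?y := y)) + ((1 - 2 * a) * R y * of_bool (y = 0)
      + (a * R y * of_bool (y = 1) + a * R y * of_bool (y = 2)))" for y
    unfolding prod_f prod_g by (auto simp: algebra_simps)
  then have "lsum N (\<lambda>y. ?G (f(?y := y)))
      = lsum N (\<lambda>y. ?G (g(?y := y)) + ((1 - 2 * a) * R y * of_bool (y = 0)
          + (a * R y * of_bool (y = 1) + a * R y * of_bool (y = 2))))"
    by (intro arg_cong[of _ _ "lsum N"] ext)
  also have "\<dots> = lsum N (\<lambda>y. ?G (g(?y := y))) + ((1 - 2 * a) * R 0 + (a * R 1 + a * R 2))"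
    by (simp only: lsum_add lsum_delta ec_add delta ec_g)
  finally show ?thesis
    by (simp add: twisted_def integ_def R algebra_simps)
qed

text \<open>The pair is invariant under its own two reflections, but each remaining singleton, the
  constant 1, becomes the non-constant \<open>1 - w (f v) / t\<close>. For \<open>l \<ge> 3\<close>
  there is at least one such singleton.\<close>

lemma pair_not_invariant:
  assumes "l \<ge> 3"
  shows "reflects (all_points 0 l) (\<lambda>f. of_bool (f (Lower 1) = f (Lower 2)))
    \<noteq> (\<lambda>f. of_bool (f (Lower 1) = f (Lower 2)))"
proof
  let ?E = "\<lambda>f. of_bool (f (Lower 1) = f (Lower 2)) :: complex"
  let ?vs = "map Lower [3..<Suc l]"
  let ?R = "\<lambda>f. \<Prod>v\<leftarrow>?vs. 1 - w (f v) / t"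
  assume inv: "reflects (all_points 0 l) ?E = ?E"
  have vs: "distinct ?vs" by (simp add: distinct_map inj_on_def)
  have "reflects ?vs (\<lambda>f. \<Prod>v\<leftarrow>?vs. 1) = (\<lambda>f. \<Prod>v\<leftarrow>?vs. reflect v (\<lambda>f. 1) f)"
    using vs by (intro reflects_prod tame_const indep_const)
  moreover have "(\<Prod>v\<leftarrow>us. 1) = (1 :: complex)" for us :: "point list"
    by (induction us) simp_all
  ultimately have R: "reflects ?vs (\<lambda>f. 1) = ?R"
    by (simp only: reflect_one)
  have "indep v ?E" if "v \<in> set ?vs" for v
  proof -
    have "v \<noteq> Lower 1" "v \<noteq> Lower 2" using that by auto
    then show ?thesis unfolding indep_def by (intro allI) (metis fun_upd_other)
  qed
  then have "reflects ?vs (\<lambda>f. ?E f * 1) = (\<lambda>f. ?E f * reflects ?vs (\<lambda>f. 1) f)"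
    by (rule reflects_mult_indep[OF tame_const])
  then have "reflects ?vs ?E = (\<lambda>f. ?R f * ?E f)"
    unfolding R mult_1_right by (simp only: mult.commute)
  then have "reflects (all_points 0 l) ?E = reflects [Lower 1, Lower 2] (\<lambda>f. ?R f * ?E f)"
    using assms by (simp only: all_points_eq[of l] reflects_simps)
  also have "\<dots> = (\<lambda>f. ?R f * reflects [Lower 1, Lower 2] ?E f)"
  proof (rule reflects_mult_indep[OF tame_eq])
    show "indep v ?R" if "v \<in> set [Lower 1, Lower 2]" for v
      using that by (intro indep_prod_list) (auto simp: indep_def)
  qed
  also have "reflects [Lower 1, Lower 2] ?E = ?E"
    by (intro reflects_eq_pair) simp
  finally have "(\<lambda>f. ?R f * ?E f) = ?E" using inv by (simp only:)
  then have ER: "?R f * ?E f = ?E f" for f by (rule fun_cong)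
  \<comment> \<open>Two labelings are compared that agree at the pair and differ only at the
    singleton \<open>Lower 3\<close>, with labels 1 and 0. Equal products would force
    \<open>w 0 = w 1\<close>, whereas these differ by 1.\<close>
  have R1: "?R (\<lambda>v. 1) = 1" using ER[of "\<lambda>v. 1"] by simp
  have split: "[3..<Suc l] = 3 # [4..<Suc l]" using assms by (simp add: upt_conv_Cons)
  let ?S = "\<Prod>i\<leftarrow>[4..<Suc l]. 1 - w 1 / t"
  have "(\<Prod>i\<leftarrow>[4..<Suc l]. 1 - w (((\<lambda>v. 1)(Lower 3 := 0)) (Lower i)) / t) = ?S"
    by (intro prod_list_cong) auto
  then have "(1 - w 0 / t) * ?S = 1"
    using ER[of "(\<lambda>v. 1)(Lower 3 := 0)"] unfolding split by (simp add: comp_def del: upt_Suc)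
  moreover have "(1 - w 1 / t) * ?S = 1"
    using R1 unfolding split by (simp add: comp_def del: upt_Suc)
  ultimately have "1 - w 0 / t = 1 - w 1 / t"
    by (metis mult_right_cancel mult_zero_right zero_neq_one)
  then show False using t_nonzero by (simp add: w_def)
qed

text \<open>In an easy category, \<open>x\<close> is a combination of partitions that belong to the
  category themselves. One of them must separate two labelings on which \<open>x\<close> takes
  different values, and the labelings are chosen so that this partition can only be the
  non-invariant one. Here \<open>a \<noteq> 0\<close> makes the difference from
  \<open>twisted_diff\<close> nonzero.\<close>

lemma not_easy_twisted:
  assumes a: "a \<noteq> 0" and l: "l \<ge> 3" and x: "x \<in> Part 0 l" "ev x = twisted l"
  shows "\<not> easy (generated N {(0, l, x)})"
proof
  let ?K = "generated N {(0, l, x)}"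
  assume "easy ?K"
  then obtain C where C: "C \<subseteq> Partitions 0 l" "?K 0 l = part.span (basis ` C)"
    unfolding easy_def by blast
  have "x \<in> ?K 0 l" by (auto simp: generated_def)
  have K_inv: "?K 0 l \<subseteq> invariants 0 l"
    using x twisted_in_invariants by (intro generated_least[OF linear_category_invariants]) auto
  \<comment> \<open>On the lower points \<open>1'\<close> to \<open>l'\<close>, \<open>g\<close> is
    injective, while \<open>f\<close> identifies exactly \<open>1'\<close> and
    \<open>2'\<close>.\<close>
  define g :: "point \<Rightarrow> nat" where "g v = (case v of Upper i \<Rightarrow> i | Lower i \<Rightarrow> i)" for v
  define f where "f = g(Lower 1 := 0, Lower 2 := 0)"
  have "ev x f - ev x g \<noteq> 0"
    unfolding x(2) using a l by (subst twisted_diff) (auto simp: f_def g_def)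
  have "\<exists>p\<in>C. agree p f \<noteq> agree p g"
  proof (rule ccontr)
    assume "\<not> ?thesis"
    then have "basis ` C \<subseteq> {z. ev z f = ev z g}" by (auto simp: ev_basis)
    moreover have "part.subspace {z. ev z f = ev z g}"
      by (auto intro!: part.subspaceI simp: ev_add ev_scale)
    ultimately have "part.span (basis ` C) \<subseteq> {z. ev z f = ev z g}"
      by (rule part.span_minimal)
    then show False using \<open>x \<in> ?K 0 l\<close> C(2) \<open>ev x f - ev x g \<noteq> 0\<close> by auto
  qed
  then obtain p where p: "p \<in> C" "agree p f \<noteq> agree p g" by blast
  have points: "\<exists>i\<in>{1..l}. v = Lower i" if "B \<in> p" "v \<in> B" for B v
    using that p(1) C(1) by (auto simp: Partitions_def partition_on_def points_def)
  have inj: "v = v'" if "g v = g v'" "B \<in> p" "v \<in> B" "v' \<in> B" for v v' B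
    using that points[OF that(2,3)] points[OF that(2,4)] by (auto simp: g_def)
  have fg: "f v = f v'" if "g v = g v'" "B \<in> p" "v \<in> B" "v' \<in> B" for v v' B
    using inj[OF that] by simp
  let ?P = "\<lambda>h. \<forall>B\<in>p. \<forall>v\<in>B. \<forall>v'\<in>B. h v = (h v' :: nat)"
  \<comment> \<open>A partition passing the test for \<open>g\<close> has only singleton blocks and
    passes every test. The separating partition \<open>p\<close> therefore passes for
    \<open>f\<close> and fails for \<open>g\<close>.\<close>
  have "?P f" if "?P g"
  proof (intro ballI)
    fix B v v' assume "B \<in> p" "v \<in> B" "v' \<in> B"
    moreover from this have "g v = g v'" using that by blast
    ultimately show "f v = f v'" using fg by blast
  qed
  moreover have "?P f \<longleftrightarrow> \<not> ?P g"
    using p(2) unfolding agree_def of_bool_eq_iff by blast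
  ultimately have Pf: "?P f" and Pg: "\<not> ?P g" by blast+
  have f1: "f v = f v'" if "B \<in> p" "v \<in> B" "v' \<in> B" for B v v'
    using Pf that by blast
  obtain B u u' where B: "B \<in> p" "u \<in> B" "u' \<in> B" "u \<noteq> u'"
    using Pg by blast
  have pair: "v = v' \<or> {v, v'} = {Lower 1, Lower 2}" if "B \<in> p" "v \<in> B" "v' \<in> B" for v v' B
  proof -
    from points[OF that(1,2)] points[OF that(1,3)]
    obtain i j where "v = Lower i" "v' = Lower j" "i \<ge> 1" "j \<ge> 1"
      by auto
    then show ?thesis
      using f1[OF that] by (auto simp: f_def g_def split: if_splits)
  qed
  have "{u, u'} = {Lower 1, Lower 2}" using pair[OF B(1-3)] B(4) by blast
  moreover have "{u, u'} \<subseteq> B" using B(2,3) by blast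
  ultimately have B12: "Lower 1 \<in> B" "Lower 2 \<in> B" by (simp_all only: insert_subset)
  have "agree p h = of_bool (h (Lower 1) = h (Lower 2))" for h
  proof -
    have "(\<forall>B\<in>p. \<forall>v\<in>B. \<forall>v'\<in>B. h v = h v') \<longleftrightarrow> h (Lower 1) = h (Lower 2)"
      (is "?l \<longleftrightarrow> ?r")
    proof
      assume r: ?r
      show ?l
      proof (intro ballI)
        fix B v v' assume "B \<in> p" "v \<in> B" "v' \<in> B"
        then consider "v = v'" | "v = Lower 1" "v' = Lower 2" | "v = Lower 2" "v' = Lower 1"
          using pair[of B v v'] unfolding doubleton_eq_iff by blast
        then show "h v = h v'" by cases (use r in simp_all)
      qed
    qed (use B(1) B12 in blast)
    then show ?thesis by (simp add: agree_def)
  qed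
  then have "ev (basis p) = (\<lambda>h. of_bool (h (Lower 1) = h (Lower 2)))"
    by (simp add: ev_basis fun_eq_iff)
  moreover have "basis p \<in> invariants 0 l"
    using p(1) C(2) K_inv part.span_base by blast
  ultimately show False
    using pair_not_invariant[OF l] by (simp add: invariants_def)
qed

end

theorem proposition6p30:
  fixes \<delta> s :: real
  assumes "\<delta> > 0" and "\<delta> \<noteq> 1" and "s \<in> {1, -1}"
  shows "\<not> easy (generated (of_real (\<delta> - 1)) {(0, 3, V_map \<delta> s 0 3 aaa)}) \<and>
         \<not> easy (generated (of_real (\<delta> - 1)) {(0, 4, V_map \<delta> s 0 4 aaaa)})"
proof -
  define t where "t = - s / sqrt \<delta>"
  define a where "a = 1 / (\<delta> - 1) * (1 + s * (1 / sqrt \<delta>))"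
  have s: "s * s = 1" using assms(3) by auto
  have sqrt: "sqrt \<delta> * sqrt \<delta> = \<delta>" "sqrt \<delta> > 0" using assms(1) by simp_all
  have aN: "a * (\<delta> - 1) = 1 - t" using assms(2) by (simp add: a_def t_def)
  have tt: "t * t * \<delta> = 1"
    using sqrt s assms(1) by (simp add: t_def)
  \<comment> \<open>The left side is \<open>(1 - t) * (1 + t)\<close>, and
    \<open>1 = t * t * \<delta>\<close>; the factor \<open>\<delta> - 1\<close> is nonzero and
    cancels.\<close>
  have "(\<delta> - 1) * (a * (1 + t)) = (\<delta> - 1) * (t * t)"
    using aN tt by algebra
  then have at: "a * (1 + t) = t * t" using assms(2) by simp
  have "t * t \<noteq> 0" using tt by auto
  then have "a \<noteq> 0" using at by auto
  interpret reflection "of_real (\<delta> - 1)" "of_real a" "of_real t"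
  proof
    show "complex_of_real a * complex_of_real (\<delta> - 1) = 1 - complex_of_real t"
      using arg_cong[OF aN, of complex_of_real] by simp
    show "complex_of_real a * (1 + complex_of_real t) = (complex_of_real t)\<^sup>2"
      using arg_cong[OF at, of complex_of_real] by (simp add: power2_eq_square)
    show "(complex_of_real t)\<^sup>2 * (1 + complex_of_real (\<delta> - 1)) = 1"
      using arg_cong[OF tt, of complex_of_real] by (simp add: power2_eq_square)
  qed simp_all
  have u: "upsilon \<delta> s = id_part - scale (of_real a) (basis {{Upper 1}, {Lower 1}})"
    by (simp add: upsilon_def a_def)
  have not_easy: "\<not> easy (generated (of_real (\<delta> - 1)) {(0, l, V_map \<delta> s 0 l (basis (block l)))})"
    if "l \<ge> 3" for l
  proof (rule not_easy_twisted)
    show "V_map \<delta> s 0 l (basis (block l)) \<in> Part 0 l"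
      using that by (intro V_map_in_Part basis_in_Part block_in) simp
    show "ev (V_map \<delta> s 0 l (basis (block l))) = twisted l"
      unfolding V_map_def using that by (intro ev_twist[OF u]) simp
  qed (use \<open>a \<noteq> 0\<close> that in simp_all)
  have "{1..3::nat} = {1, 2, 3}" "{1..4::nat} = {1, 2, 3, 4}" by auto
  then have "aaa = basis (block 3)" "aaaa = basis (block 4)"
    by (simp_all add: aaa_def aaaa_def block_def)
  then show ?thesis using not_easy[of 3] not_easy[of 4] by simp
qed

end
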